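(* Let $p\in(0,1)$ and $A,B\in\mathcal{H}_n^{(\beta)}$. For any $t\in\mathbb{R}$, $$\Big|\sum_{i=1}^n(t-\lambda_i(A))_+^p-\sum_{i=1}^n(t-\lambda_i(B))_+^p\Big|\le\sum_{i=1}^n|\lambda_i(A-B)|^p,$$ where $\lambda_1(C),\dots,\lambda_n(C)$ denote the eigenvalues of a matrix $C\in\mathcal{H}_n^{(\beta)}$. Furthermore, there is a positive constant $C_p$ such that for any $A,B\in\mathcal{H}_n^{(\beta)}$, $$d(\mu_A,\mu_B)\le\frac{C_p}{n}\|A-B\|_{\ell^p}^p,$$ with $$C_p=\sqrt\pi\,(p+1)\frac{\Gamma\big(\frac{p+1}2\big)}{\Gamma\big(1+\frac p2\big)}.$$
   Context: $\mathcal{H}_n^{(\beta)}$ is the set of $n\times n$ Hermitian matrices if $\beta=2$ and real symmetric matrices if $\beta=1$. $\mu_A=\frac1n\sum_i\delta_{\lambda_i(A)}$ is the empirical spectral measure of $A$. $\|Y\|_{\ell^p}^p=\sum_{i,j}|Y_{i,j}|^p$ (entrywise). $x_+=\max(x,0)$ and $x_+^p=(x_+)^p$. The distance $d$ on probability measures on $\mathbb{R}$ is $d(\mu,\nu)=\sup_{z\in\mathcal{K}}|g_\mu(z)-g_\nu(z)|$, where $g_\mu(z)=\int\frac{d\mu(t)}{z-t}$ is the Stieltjes transform and $\mathcal{K}$ is a fixed compact subset of $\{z\in\mathbb{C}:\mathrm{Im}\,z\ge2\}$ with an accumulation point and with $\mathrm{diam}(\mathcal{K})\le1$. *)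

theory Defs
  imports
    "HOL-Probability.Probability"
    "HOL-Computational_Algebra.Fundamental_Theorem_Algebra"
    "Jordan_Normal_Form.Char_Poly"
    "Jordan_Normal_Form.Schur_Decomposition"
begin

text \<open>
  Real symmetric matrices are represented as complex matrices all of whose entries lie in
  \<^term>\<open>\<real> :: complex set\<close>, so that both symmetry classes live in one type. Only
  \<open>\<beta> = 1\<close> and \<open>\<beta> = 2\<close> are meaningful.
\<close>

definition Herm :: "nat \<Rightarrow> nat \<Rightarrow> complex mat set" where
  "Herm \<beta> n =
     (if \<beta> = 1
      then {A \<in> carrier_mat n n. transpose_mat A = A \<and> elements_mat A \<subseteq> \<real>}
      else {A \<in> carrier_mat n n. mat_adjoint A = A})"

text \<open>
  Eigenvalues are counted with algebraic multiplicity and listed in nondecreasing order. The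
  projection \<^term>\<open>Re\<close> only serves to obtain values of type \<^typ>\<open>real\<close>; it loses nothing on
  \<^term>\<open>Herm\<close>, see \<open>mset_eigvals\<close> below.
\<close>

definition eigvals :: "complex mat \<Rightarrow> real list" where
  "eigvals A = sorted_list_of_multiset (image_mset Re (proots (char_poly A)))"

definition eigval :: "complex mat \<Rightarrow> nat \<Rightarrow> real" where
  "eigval A i = eigvals A ! (i - 1)"

definition spectral_measure :: "nat \<Rightarrow> complex mat \<Rightarrow> real measure" where
  "spectral_measure n A = distr (uniform_count_measure {1..n}) borel (eigval A)"

definition stieltjes :: "real measure \<Rightarrow> complex \<Rightarrow> complex" where
  "stieltjes \<mu> z = (LINT t|\<mu>. 1 / (z - complex_of_real t))"

definition stieltjes_dist :: "complex set \<Rightarrow> real measure \<Rightarrow> real measure \<Rightarrow> real" where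
  "stieltjes_dist K \<mu> \<nu> = (SUP z\<in>K. cmod (stieltjes \<mu> z - stieltjes \<nu> z))"

definition admissible_set :: "complex set \<Rightarrow> bool" where
  "admissible_set K \<longleftrightarrow>
     compact K \<and> K \<subseteq> {z. Im z \<ge> 2} \<and> (\<exists>z. z islimpt K) \<and> diameter K \<le> 1"

text \<open>The \<open>p\<close>-th power of the entrywise \<open>\<ell>\<^sup>p\<close> (quasi-)norm.\<close>

definition lp_norm_powr :: "real \<Rightarrow> complex mat \<Rightarrow> real" where
  "lp_norm_powr p Y = (\<Sum>i<dim_row Y. \<Sum>j<dim_col Y. cmod (Y $$ (i, j)) powr p)"

lemma Herm_adjoint:
  assumes "A \<in> Herm \<beta> n"
  shows "A \<in> carrier_mat n n" "mat_adjoint A = A"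
proof -
  show c: "A \<in> carrier_mat n n"
    using assms by (auto simp: Herm_def split: if_splits)
  show "mat_adjoint A = A"
  proof (cases "\<beta> = 1")
    case True
    then have t: "transpose_mat A = A" and r: "elements_mat A \<subseteq> \<real>"
      using assms by (auto simp: Herm_def)
    show ?thesis
    proof (rule eq_matI)
      fix i j assume ij: "i < dim_row A" "j < dim_col A"
      have "A $$ (j, i) \<in> elements_mat A"
        using ij c by auto
      then have "cnj (A $$ (j, i)) = A $$ (j, i)"
        using r by (auto simp: Reals_cnj_iff)
      moreover have "A $$ (j, i) = A $$ (i, j)"
        using t ij c by (metis carrier_matD(1,2) index_transpose_mat(1))
      ultimately show "mat_adjoint A $$ (i, j) = A $$ (i, j)"
        using ij c by (simp add: mat_adjoint_def mat_of_rows_def)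
    qed (use c in \<open>auto simp: mat_adjoint_def\<close>)
  qed (use assms in \<open>simp add: Herm_def\<close>)
qed

lemma length_eigvals:
  assumes "A \<in> carrier_mat n n"
  shows "length (eigvals A) = n"
proof -
  have "length (eigvals A) = size (mset (eigvals A))"
    by simp
  also have "\<dots> = size (proots (char_poly A))"
    unfolding eigvals_def mset_sorted_list_of_multiset by simp
  also have "\<dots> = n"
    using degree_monic_char_poly[OF assms] by (simp add: size_proots_complex)
  finally show ?thesis .
qed

lemma Herm_eigenvalue_real:
  assumes "A \<in> Herm \<beta> n" "eigenvalue A k"
  shows "k \<in> \<real>"
proof -
  note c = Herm_adjoint(1)[OF assms(1)] and h = Herm_adjoint(2)[OF assms(1)]
  obtain v where v: "v \<in> carrier_vec n" "v \<noteq> 0\<^sub>v n" "A *\<^sub>v v = k \<cdot>\<^sub>v v"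
    using assms(2) c by (auto simp: eigenvalue_def eigenvector_def)
  have ent: "A $$ (i, j) = cnj (A $$ (j, i))" if "i < n" "j < n" for i j
  proof -
    have "mat_adjoint A $$ (i, j) = cnj (A $$ (j, i))"
      using that c by (simp add: mat_adjoint_def mat_of_rows_def)
    then show ?thesis using h by simp
  qed
  define q where "q = (\<Sum>i<n. cnj (v $ i) * (\<Sum>j<n. A $$ (i, j) * v $ j))"
  define s where "s = (\<Sum>i<n. (cmod (v $ i))\<^sup>2)"
  have Av: "(\<Sum>j<n. A $$ (i, j) * v $ j) = k * v $ i" if "i < n" for i
  proof -
    have "(A *\<^sub>v v) $ i = (\<Sum>j<n. A $$ (i, j) * v $ j)"
      using that c v(1) by (auto simp: scalar_prod_def atLeast0LessThan intro!: sum.cong)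
    then show ?thesis using v(1,3) that by simp
  qed
  have "q = (\<Sum>i<n. cnj (v $ i) * (k * v $ i))"
    by (simp add: q_def Av)
  also have "\<dots> = k * of_real s"
    unfolding s_def of_real_sum sum_distrib_left
    by (intro sum.cong) (simp_all add: complex_norm_square mult_ac del: of_real_power)
  finally have q1: "q = k * of_real s" .
  have "cnj q = (\<Sum>i<n. \<Sum>j<n. v $ i * cnj (A $$ (i, j)) * cnj (v $ j))"
    by (simp add: q_def sum_distrib_left mult_ac)
  also have "\<dots> = (\<Sum>i<n. \<Sum>j<n. v $ i * A $$ (j, i) * cnj (v $ j))"
    by (intro sum.cong refl) (simp add: ent[symmetric])
  also have "\<dots> = (\<Sum>j<n. \<Sum>i<n. v $ i * A $$ (j, i) * cnj (v $ j))"
    by (rule sum.swap)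
  also have "\<dots> = q"
    by (simp add: q_def sum_distrib_left mult_ac)
  finally have q2: "cnj q = q" .
  have "s \<noteq> 0"
  proof
    assume "s = 0"
    then have "\<forall>i<n. v $ i = 0"
      unfolding s_def by (subst (asm) sum_nonneg_eq_0_iff) auto
    then have "v = 0\<^sub>v n"
      using v(1) by (intro eq_vecI) auto
    with v(2) show False by simp
  qed
  with q1 q2 have "cnj k = k" by simp
  then show ?thesis by (simp add: Reals_cnj_iff)
qed

lemma mset_eigvals:
  assumes "A \<in> Herm \<beta> n"
  shows "image_mset complex_of_real (mset (eigvals A)) = proots (char_poly A)"
proof -
  note c = Herm_adjoint(1)[OF assms]
  have nz: "char_poly A \<noteq> 0"
    using degree_monic_char_poly[OF c] by auto
  have "complex_of_real (Re k) = k" if "k \<in># proots (char_poly A)" for k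
    using that nz eigenvalue_root_char_poly[OF c, of k] Herm_eigenvalue_real[OF assms, of k]
    by simp
  then show ?thesis
    unfolding eigvals_def mset_sorted_list_of_multiset
    by (simp add: multiset.map_comp o_def multiset.map_ident_strong)
qed

lemma measure_spectral_measure:
  assumes "n \<ge> 1" "S \<in> sets borel"
  shows "measure (spectral_measure n A) S = (1 / real n) * (\<Sum>i=1..n. indicator S (eigval A i))"
proof -
  have "measure (spectral_measure n A) S =
        measure (uniform_count_measure {1..n}) (eigval A -` S \<inter> {1..n})"
    using assms
    by (subst spectral_measure_def, subst measure_distr)
       (auto simp: measurable_def space_uniform_count_measure sets_uniform_count_measure)
  also have "\<dots> = card (eigval A -` S \<inter> {1..n}) / n"
    using assms by (subst measure_uniform_count_measure) auto
  also have "real (card (eigval A -` S \<inter> {1..n})) = (\<Sum>i=1..n. indicator S (eigval A i))"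
    by (simp add: indicator_def sum.If_cases Int_commute vimage_def Collect_conj_eq)
  finally show ?thesis by simp
qed

end

theory Submission
  imports Defs "Jordan_Normal_Form.Spectral_Radius"
begin

text \<open>
  Write \<open>F\<^sub>t(A) = \<Sum>\<^sub>i (t - \<lambda>\<^sub>i(A))\<^sub>+\<^sup>p\<close>. Everything rests on how \<open>F\<^sub>t\<close> reacts to
  adding a matrix \<open>c u u\<^sup>*\<close> with \<open>u\<close> a unit vector. For \<open>c \<ge> 0\<close> the eigenvalues of the two
  matrices interlace, so the intervals between the \<open>i\<close>-th old and the \<open>i\<close>-th new eigenvalue do not
  overlap, and by the trace their total length is \<open>c\<close>. Since \<open>x \<mapsto> x\<^sub>+\<^sup>p\<close> vanishes on the negative
  axis and is concave on the positive one, its total increase over disjoint intervals of total length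
  \<open>c\<close> is largest when they are packed together from \<open>0\<close> on, that is, at most \<open>c\<^sup>p\<close>. Exchanging the
  roles of the matrices when \<open>c < 0\<close>, one gets a change of at most \<open>\<bar>c\<bar>\<^sup>p\<close>
  (\<open>trunc_trace_rank_one\<close>). Passing from \<open>B\<close> to \<open>A\<close> along any decomposition
  \<open>A - B = \<Sum>\<^sub>k c\<^sub>k u\<^sub>k u\<^sub>k\<^sup>*\<close> with unit vectors therefore gives
  \<open>\<bar>F\<^sub>t(A) - F\<^sub>t(B)\<bar> \<le> \<Sum>\<^sub>k \<bar>c\<^sub>k\<bar>\<^sup>p\<close> (\<open>trunc_trace_sum_rank_one\<close>).

  Two decompositions are used. The spectral one gives the first inequality. The other one writes each
  pair of conjugate off-diagonal entries as a difference of two rank-one matrices of weight equal to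
  the modulus of the entry; it bounds \<open>F\<^sub>t(A) - F\<^sub>t(B)\<close> directly by the entrywise
  \<open>\<ell>\<^sup>p\<close> quantity, with no comparison between eigenvalues and entries of \<open>A - B\<close>.

  For the Stieltjes transform, fractional integration gives
  \<open>1 / (z - x) = - (p + 1) \<integral> (t - x)\<^sub>+\<^sup>p (t - z)\<^sup>-\<^sup>p\<^sup>-\<^sup>2 dt\<close> (\<open>resolvent_eq_integral\<close>), since
  \<open>((t - x) / (t - z))\<^sup>p\<^sup>+\<^sup>1\<close> is a primitive of the integrand up to a factor. Summing over
  eigenvalues, the difference of the transforms is at most \<open>(p + 1) / n\<close> times
  \<open>sup\<^sub>t \<bar>F\<^sub>t(A) - F\<^sub>t(B)\<bar>\<close> times \<open>\<integral> \<bar>t - z\<bar>\<^sup>-\<^sup>p\<^sup>-\<^sup>2 dt\<close>. As \<open>Im z \<ge> 2\<close>, the last integral is at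
  most \<open>\<integral> dt / (4 + t\<^sup>2) = \<pi> / 2\<close>. This is below \<open>\<surd>\<pi>\<close>, and the quotient of Gamma values in the
  constant is at least \<open>1\<close> because \<open>\<Gamma> \<ge> 1\<close> on \<open>(0, 1]\<close> and \<open>\<Gamma> \<le> 1\<close> on \<open>[1, 2]\<close>.
\<close>

section \<open>Orthonormal systems in complex coordinate space\<close>

text \<open>
  Vectors are functions on \<open>nat\<close> of which only the values below \<open>n\<close> matter. This makes
  linear combinations and changes of basis plain manipulations of finite sums.
\<close>

definition cinner :: "nat \<Rightarrow> (nat \<Rightarrow> complex) \<Rightarrow> (nat \<Rightarrow> complex) \<Rightarrow> complex" where
  "cinner n x y = (\<Sum>i<n. cnj (x i) * y i)"

definition orthonormal :: "nat \<Rightarrow> nat \<Rightarrow> (nat \<Rightarrow> nat \<Rightarrow> complex) \<Rightarrow> bool" where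
  "orthonormal n m v \<longleftrightarrow> (\<forall>k<m. \<forall>l<m. cinner n (v k) (v l) = of_bool (k = l))"

lemma cnj_cinner: "cnj (cinner n x y) = cinner n y x"
  by (simp add: cinner_def mult.commute)

lemma cinner_self: "cinner n x x = complex_of_real (\<Sum>i<n. (cmod (x i))\<^sup>2)"
  by (simp add: cinner_def complex_norm_square mult.commute del: of_real_power)

lemma cinner_sum_right: "cinner n x (\<lambda>i. \<Sum>k\<in>K. c k * y k i) = (\<Sum>k\<in>K. c k * cinner n x (y k))"
  unfolding cinner_def sum_distrib_left
  by (subst sum.swap) (simp add: mult_ac)

lemma cinner_scale_right: "cinner n x (\<lambda>i. c * y i) = c * cinner n x y"
  by (simp add: cinner_def sum_distrib_left mult_ac)

lemma cinner_scale_left: "cinner n (\<lambda>i. c * x i) y = cnj c * cinner n x y"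
  by (simp add: cinner_def sum_distrib_left mult_ac)

lemma cinner_normalize:
  assumes "i < n" "x i \<noteq> 0"
  shows "\<exists>c. cinner n (\<lambda>i. c * x i) (\<lambda>i. c * x i) = 1"
proof -
  define s where "s = (\<Sum>i<n. (cmod (x i))\<^sup>2)"
  have "s > 0"
    unfolding s_def using assms by (intro sum_pos2[of _ i]) auto
  then have "complex_of_real (1 / sqrt s) * complex_of_real (1 / sqrt s) * of_real s = 1"
    by (simp flip: of_real_mult)
  moreover have "cinner n x x = of_real s"
    by (simp add: cinner_self s_def)
  ultimately have "cinner n (\<lambda>i. of_real (1 / sqrt s) * x i) (\<lambda>i. of_real (1 / sqrt s) * x i) = 1"
    unfolding cinner_scale_right cinner_scale_left by (simp only: complex_cnj_complex_of_real mult.assoc)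
  then show ?thesis by (rule exI)
qed

text \<open>
  The space \<open>Herm 2 n\<close> contains both symmetry classes, and all spectral estimates below are carried
  out in it, by means of this entrywise description.
\<close>

lemma Herm_2_iff:
  "A \<in> Herm 2 n \<longleftrightarrow>
     A \<in> carrier_mat n n \<and> (\<forall>i<n. \<forall>j<n. A $$ (i, j) = cnj (A $$ (j, i)))"
proof -
  have "mat_adjoint A = A \<longleftrightarrow> (\<forall>i<n. \<forall>j<n. A $$ (i, j) = cnj (A $$ (j, i)))"
    if c: "A \<in> carrier_mat n n"
  proof -
    have e: "mat_adjoint A $$ (i, j) = cnj (A $$ (j, i))" if "i < n" "j < n" for i j
      using that c by (simp add: mat_adjoint_def mat_of_rows_def)
    have "mat_adjoint A \<in> carrier_mat n n"
      using c by (auto simp: mat_adjoint_def)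
    then have "mat_adjoint A = A \<longleftrightarrow> (\<forall>i<n. \<forall>j<n. mat_adjoint A $$ (i, j) = A $$ (i, j))"
      using c by (auto simp: mat_eq_iff)
    also have "\<dots> \<longleftrightarrow> (\<forall>i<n. \<forall>j<n. A $$ (i, j) = cnj (A $$ (j, i)))"
      using e by (metis (no_types))
    finally show ?thesis .
  qed
  then show ?thesis
    by (auto simp: Herm_def)
qed

lemma Herm_2_carrier: "A \<in> Herm 2 n \<Longrightarrow> A \<in> carrier_mat n n"
  by (simp add: Herm_2_iff)

lemma Herm_2_cnj:
  assumes "A \<in> Herm 2 n" "i < n" "j < n"
  shows "cnj (A $$ (j, i)) = A $$ (i, j)"
proof -
  have "A $$ (i, j) = cnj (A $$ (j, i))"
    using assms unfolding Herm_2_iff by blast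
  then show ?thesis by (rule sym)
qed

lemma Herm_subset_Herm_2: "Herm \<beta> n \<subseteq> Herm 2 n"
proof
  fix A assume "A \<in> Herm \<beta> n"
  from Herm_adjoint[OF this] show "A \<in> Herm 2 n"
    by (simp add: Herm_def)
qed

text \<open>
  A dimension count, phrased with determinants: fewer than \<open>n\<close> linear conditions, padded with
  zero rows to a square system, have determinant \<open>0\<close> and hence a nontrivial solution. It serves
  both to extend orthonormal systems and to find the test vector in \<open>weyl_codimension\<close>.
\<close>

lemma ex_unit_orthogonal:
  assumes "m < n"
  shows "\<exists>x. cinner n x x = 1 \<and> (\<forall>k<m. cinner n (u k) x = 0)"
proof -
  define M where "M = mat n n (\<lambda>(k, i). if k < m then cnj (u k i) else 0)"
  have M: "M \<in> carrier_mat n n"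
    by (simp add: M_def)
  have "M = mat\<^sub>r n n (\<lambda>k. if k = n - 1 then 0\<^sub>v n else row M k)"
    using assms by (intro eq_matI) (auto simp: M_def)
  then have "det M = 0"
    using det_row_0[of "n - 1" n "row M"] assms M by auto
  then obtain v where v: "v \<in> carrier_vec n" "v \<noteq> 0\<^sub>v n" "M *\<^sub>v v = 0\<^sub>v n"
    using det_0_iff_vec_prod_zero_field[OF M] by blast
  have "\<exists>i<n. v $ i \<noteq> 0"
    using v(1,2) by (metis carrier_vecD eq_vecI index_zero_vec)
  then obtain c where c: "cinner n (\<lambda>i. c * v $ i) (\<lambda>i. c * v $ i) = 1"
    using cinner_normalize by blast
  have orth: "cinner n (u k) (($) v) = 0" if "k < m" for k
  proof -
    have "0 = (M *\<^sub>v v) $ k"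
      using v that assms by simp
    also have "\<dots> = (\<Sum>i<n. M $$ (k, i) * v $ i)"
      using that assms M v(1)
      by (auto simp: scalar_prod_def atLeast0LessThan intro!: sum.cong)
    also have "\<dots> = cinner n (u k) (($) v)"
      using that assms unfolding cinner_def
      by (intro sum.cong) (auto simp: M_def)
    finally show ?thesis by simp
  qed
  have "cinner n (u k) (\<lambda>i. c * v $ i) = 0" if "k < m" for k
    using orth[OF that] by (simp add: cinner_scale_right)
  with c show ?thesis by (intro exI[of _ "\<lambda>i. c * v $ i"]) simp
qed

lemma orthonormal_snoc:
  assumes "orthonormal n m v" "cinner n x x = 1" "\<And>k. k < m \<Longrightarrow> cinner n (v k) x = 0"
  shows "orthonormal n (Suc m) (v(m := x))"
proof -
  have "cinner n x (v k) = 0" if "k < m" for k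
    using assms(3)[OF that] cnj_cinner[of n "v k" x] by simp
  then show ?thesis
    using assms by (auto simp: orthonormal_def less_Suc_eq)
qed

lemma orthonormal_extend:
  assumes "orthonormal n m v" "m \<le> n"
  shows "\<exists>w. orthonormal n n w \<and> (\<forall>k<m. w k = v k)"
proof -
  have "\<exists>w. orthonormal n k w \<and> (\<forall>l<m. w l = v l)" if "m \<le> k" "k \<le> n" for k
    using that
  proof (induction k rule: dec_induct)
    case base
    show ?case using assms(1) by (intro exI[of _ v]) simp
  next
    case (step k)
    then obtain w where w: "orthonormal n k w" "\<forall>l<m. w l = v l"
      by auto
    obtain x where "cinner n x x = 1" "\<forall>l<k. cinner n (w l) x = 0"
      using ex_unit_orthogonal[of k n w] step by auto
    then have "orthonormal n (Suc k) (w(k := x))"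
      using w(1) by (intro orthonormal_snoc) auto
    moreover have "\<forall>l<m. (w(k := x)) l = v l"
      using w(2) step.hyps(1) by simp
    ultimately show ?case by (intro exI conjI)
  qed
  from this[of n] assms(2) show ?thesis by simp
qed

text \<open>
  The relations say that a matrix has a left inverse; for square matrices it is also a right inverse.
\<close>

lemma orthonormal_complete:
  assumes "orthonormal n n v" "i < n" "j < n"
  shows "(\<Sum>k<n. v k i * cnj (v k j)) = of_bool (i = j)"
proof -
  define U where "U = mat n n (\<lambda>(i, k). v k i)"
  define W where "W = mat n n (\<lambda>(k, i). cnj (v k i))"
  have UW: "U \<in> carrier_mat n n" "W \<in> carrier_mat n n"
    by (simp_all add: U_def W_def)
  have "W * U = 1\<^sub>m n"
    using assms(1)
    by (intro eq_matI)
       (auto simp: U_def W_def scalar_prod_def orthonormal_def cinner_def atLeast0LessThan)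
  then have "U * W = 1\<^sub>m n"
    using mat_mult_left_right_inverse[OF UW(2,1)] by blast
  then have "(U * W) $$ (i, j) = of_bool (i = j)"
    using assms by simp
  then show ?thesis
    using assms by (simp add: U_def W_def scalar_prod_def atLeast0LessThan)
qed

lemma parseval:
  assumes "orthonormal n n v"
  shows "cinner n x x = of_real (\<Sum>k<n. (cmod (cinner n (v k) x))\<^sup>2)"
proof -
  have "(\<Sum>k<n. cnj (cinner n (v k) x) * cinner n (v k) x) =
        (\<Sum>k<n. \<Sum>i<n. \<Sum>j<n. (v k i * cnj (v k j)) * (cnj (x i) * x j))"
    unfolding cinner_def cnj_sum sum_product by (simp add: mult_ac)
  also have "\<dots> = (\<Sum>i<n. \<Sum>k<n. \<Sum>j<n. (v k i * cnj (v k j)) * (cnj (x i) * x j))"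
    by (rule sum.swap)
  also have "\<dots> = (\<Sum>i<n. \<Sum>j<n. \<Sum>k<n. (v k i * cnj (v k j)) * (cnj (x i) * x j))"
    by (intro sum.cong refl sum.swap)
  also have "\<dots> = (\<Sum>i<n. \<Sum>j<n. of_bool (i = j) * (cnj (x i) * x j))"
    using orthonormal_complete[OF assms] by (simp flip: sum_distrib_right)
  also have "\<dots> = cinner n x x"
    by (simp add: cinner_def of_bool_def if_distrib if_distribR cong: if_cong)
  finally show ?thesis
    by (simp add: complex_norm_square mult.commute del: of_real_power)
qed

section \<open>The spectral theorem\<close>

definition apply_mat :: "nat \<Rightarrow> complex mat \<Rightarrow> (nat \<Rightarrow> complex) \<Rightarrow> nat \<Rightarrow> complex" where
  "apply_mat n A x i = (\<Sum>j<n. A $$ (i, j) * x j)"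

lemma apply_mat_sum: "apply_mat n A (\<lambda>i. \<Sum>k\<in>K. c k * y k i) = (\<lambda>i. \<Sum>k\<in>K. c k * apply_mat n A (y k) i)"
proof
  fix i
  show "apply_mat n A (\<lambda>i. \<Sum>k\<in>K. c k * y k i) i = (\<Sum>k\<in>K. c k * apply_mat n A (y k) i)"
    unfolding apply_mat_def sum_distrib_left by (subst sum.swap) (simp add: mult_ac)
qed

lemma apply_mat_scale: "apply_mat n A (\<lambda>i. c * x i) i = c * apply_mat n A x i"
  by (simp add: apply_mat_def sum_distrib_left mult_ac)

lemma cinner_cong: "(\<And>i. i < n \<Longrightarrow> x i = x' i) \<Longrightarrow> (\<And>i. i < n \<Longrightarrow> y i = y' i) \<Longrightarrow> cinner n x y = cinner n x' y'"
  by (simp add: cinner_def)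

lemma cinner_apply_mat_selfadjoint:
  assumes "A \<in> Herm 2 n"
  shows "cinner n x (apply_mat n A y) = cinner n (apply_mat n A x) y"
proof -
  have "cinner n x (apply_mat n A y) = (\<Sum>i<n. \<Sum>j<n. cnj (x i) * (cnj (A $$ (j, i)) * y j))"
    unfolding cinner_def apply_mat_def sum_distrib_left
    by (intro sum.cong refl) (simp add: Herm_2_cnj[OF assms])
  also have "\<dots> = (\<Sum>j<n. \<Sum>i<n. cnj (x i) * (cnj (A $$ (j, i)) * y j))"
    by (rule sum.swap)
  also have "\<dots> = cinner n (apply_mat n A x) y"
    by (simp add: cinner_def apply_mat_def sum_distrib_left sum_distrib_right mult_ac)
  finally show ?thesis .
qed

lemma orthonormal_expansion:
  assumes "orthonormal n n v" "i < n"
  shows "x i = (\<Sum>k<n. cinner n (v k) x * v k i)"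
proof -
  have "(\<Sum>k<n. cinner n (v k) x * v k i) = (\<Sum>k<n. \<Sum>j<n. v k i * cnj (v k j) * x j)"
    by (simp add: cinner_def sum_distrib_left sum_distrib_right mult_ac)
  also have "\<dots> = (\<Sum>j<n. \<Sum>k<n. v k i * cnj (v k j) * x j)"
    by (rule sum.swap)
  also have "\<dots> = (\<Sum>j<n. of_bool (i = j) * x j)"
    using orthonormal_complete[OF assms(1)] assms(2) by (simp flip: sum_distrib_right)
  also have "\<dots> = x i"
    using assms(2) by (simp add: of_bool_def if_distrib if_distribR cong: if_cong)
  finally show ?thesis by simp
qed

text \<open>
  The orthogonal complement of a set of eigenvectors is invariant under a Hermitian matrix. In
  coordinates: complete the eigenvectors to an orthonormal basis \<open>w\<close> and compress the matrix to the span
  of the new vectors; an eigenvector of the compression is an eigenvector of the whole matrix.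
\<close>

lemma ex_eigenvector_orthogonal:
  assumes A: "A \<in> Herm 2 n" and v: "orthonormal n m v" and "m < n"
    and ev: "\<And>k i. k < m \<Longrightarrow> i < n \<Longrightarrow> apply_mat n A (v k) i = lam k * v k i"
  shows "\<exists>x \<mu>. cinner n x x = 1 \<and> (\<forall>k<m. cinner n (v k) x = 0) \<and> (\<forall>i<n. apply_mat n A x i = \<mu> * x i)"
proof -
  obtain w where w: "orthonormal n n w" "\<And>k. k < m \<Longrightarrow> w k = v k"
    using orthonormal_extend[OF v] \<open>m < n\<close> by auto
  define r where "r = n - m"
  have r: "n = m + r" "r > 0"
    using \<open>m < n\<close> by (auto simp: r_def)
  \<comment> \<open>the compression of \<open>A\<close> to the orthogonal complement\<close>
  define C where "C = mat r r (\<lambda>(a, b). cinner n (w (m + a)) (apply_mat n A (w (m + b))))"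
  have C: "C \<in> carrier_mat r r"
    by (simp add: C_def)
  obtain \<mu> where "eigenvalue C \<mu>"
    using spectrum_non_empty[OF C] r(2) by (auto simp: spectrum_def)
  then obtain y where y: "y \<in> carrier_vec r" "y \<noteq> 0\<^sub>v r" "C *\<^sub>v y = \<mu> \<cdot>\<^sub>v y"
    using C by (auto simp: eigenvalue_def eigenvector_def)
  have Cy: "(\<Sum>b<r. y $ b * cinner n (w (m + a)) (apply_mat n A (w (m + b)))) = \<mu> * y $ a" if "a < r" for a
  proof -
    have "(C *\<^sub>v y) $ a = (\<Sum>b<r. y $ b * cinner n (w (m + a)) (apply_mat n A (w (m + b))))"
      using that y(1) by (auto simp: C_def scalar_prod_def atLeast0LessThan intro!: sum.cong)
    then show ?thesis using y that by simp
  qed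
  define u where "u i = (\<Sum>b<r. y $ b * w (m + b) i)" for i
  have wu: "cinner n (w l) u = (\<Sum>b<r. y $ b * of_bool (l = m + b))" if "l < n" for l
    using w(1) that r unfolding u_def cinner_sum_right
    by (intro sum.cong refl) (simp add: orthonormal_def)
  have wu_low: "cinner n (v l) u = 0" if "l < m" for l
    using wu[of l] that r w(2) by simp
  have wu_high: "cinner n (w (m + a)) u = y $ a" if "a < r" for a
    using wu[of "m + a"] that r
    by (simp add: of_bool_def if_distrib cong: if_cong)
  have wAu: "cinner n (w l) (apply_mat n A u) = cinner n (w l) (\<lambda>i. \<mu> * u i)" if "l < n" for l
  proof (cases "l < m")
    case True
    have "cinner n (w l) (apply_mat n A u) = cinner n (apply_mat n A (v l)) u"
      using cinner_apply_mat_selfadjoint[OF A] w(2)[OF True] by simp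
    also have "\<dots> = cinner n (\<lambda>i. lam l * v l i) u"
      using ev[OF True] by (intro cinner_cong) auto
    also have "\<dots> = 0"
      using wu_low[OF True] by (simp add: cinner_scale_left)
    finally show ?thesis
      using wu_low[OF True] w(2)[OF True] by (simp add: cinner_scale_right)
  next
    case False
    define a where "a = l - m"
    have a: "l = m + a" "a < r"
      using False that r by (auto simp: a_def)
    have "cinner n (w l) (apply_mat n A u) = (\<Sum>b<r. y $ b * cinner n (w l) (apply_mat n A (w (m + b))))"
      unfolding u_def apply_mat_sum by (rule cinner_sum_right)
    also have "\<dots> = \<mu> * y $ a"
      using Cy a by simp
    finally show ?thesis
      using wu_high a by (simp add: cinner_scale_right)
  qed
  have Au: "apply_mat n A u i = \<mu> * u i" if "i < n" for i
  proof -
    have "apply_mat n A u i = (\<Sum>k<n. cinner n (w k) (apply_mat n A u) * w k i)"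
      by (rule orthonormal_expansion[OF w(1) that])
    also have "\<dots> = (\<Sum>k<n. cinner n (w k) (\<lambda>i. \<mu> * u i) * w k i)"
      by (simp add: wAu)
    also have "\<dots> = \<mu> * u i"
      by (rule orthonormal_expansion[OF w(1) that, symmetric])
    finally show ?thesis .
  qed
  obtain a where a: "a < r" "y $ a \<noteq> 0"
    using y(1,2) by (metis carrier_vecD eq_vecI index_zero_vec)
  have "\<exists>i<n. u i \<noteq> 0"
  proof (rule ccontr)
    assume "\<not> ?thesis"
    then have "cinner n (w (m + a)) u = 0"
      by (simp add: cinner_def)
    with wu_high a show False by simp
  qed
  then obtain c where c: "cinner n (\<lambda>i. c * u i) (\<lambda>i. c * u i) = 1"
    using cinner_normalize by blast
  show ?thesis
  proof (intro exI conjI allI impI)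
    show "cinner n (\<lambda>i. c * u i) (\<lambda>i. c * u i) = 1" by (rule c)
    show "cinner n (v k) (\<lambda>i. c * u i) = 0" if "k < m" for k
      using wu_low[OF that] by (simp add: cinner_scale_right)
    show "apply_mat n A (\<lambda>i. c * u i) i = \<mu> * (c * u i)" if "i < n" for i
      using Au[OF that] by (simp add: apply_mat_scale)
  qed
qed

lemma ex_orthonormal_eigenvectors:
  assumes A: "A \<in> Herm 2 n" and "m \<le> n"
  shows "\<exists>v lam. orthonormal n m v \<and> (\<forall>k<m. \<forall>i<n. apply_mat n A (v k) i = lam k * v k i)"
  using assms(2)
proof (induction m)
  case 0
  show ?case by (simp add: orthonormal_def)
next
  case (Suc m)
  then obtain v lam where v: "orthonormal n m v"
      "\<forall>k<m. \<forall>i<n. apply_mat n A (v k) i = lam k * v k i"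
    by auto
  obtain x \<mu> where x: "cinner n x x = 1" "\<forall>k<m. cinner n (v k) x = 0" "\<forall>i<n. apply_mat n A x i = \<mu> * x i"
    using ex_eigenvector_orthogonal[OF A v(1), of lam] v(2) Suc.prems by auto
  show ?case
  proof (intro exI conjI)
    show "orthonormal n (Suc m) (v(m := x))"
      using v(1) x by (intro orthonormal_snoc) auto
    show "\<forall>k<Suc m. \<forall>i<n. apply_mat n A ((v(m := x)) k) i = (lam(m := \<mu>)) k * (v(m := x)) k i"
      using v(2) x(3) by (auto simp: less_Suc_eq)
  qed
qed

lemma proots_prod_linear: "proots (\<Prod>a\<leftarrow>as. [:- a, 1 :: complex:]) = mset as"
proof (induction as)
  case (Cons a as)
  have "(\<Prod>a\<leftarrow>as. [:- a, 1 :: complex:]) \<noteq> 0"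
    by (auto simp: prod_list_zero_iff)
  then have "proots ([:- a, 1:] * (\<Prod>a\<leftarrow>as. [:- a, 1:])) = proots [:- a, 1:] + mset as"
    using Cons.IH by (subst proots_mult) simp_all
  then show ?case by (simp del: mult_pCons_left)
qed simp

text \<open>
  Eigenvalues were defined through the characteristic polynomial; an orthonormal eigenbasis makes
  the matrix similar to a diagonal one, so the multiplicities agree.
\<close>

lemma mset_eigvals_eigenbasis:
  assumes A: "A \<in> carrier_mat n n" and v: "orthonormal n n v"
    and ev: "\<And>k i. k < n \<Longrightarrow> i < n \<Longrightarrow> apply_mat n A (v k) i = lam k * v k i"
  shows "mset (eigvals A) = mset (map (\<lambda>k. Re (lam k)) [0..<n])"
proof -
  define U where "U = mat n n (\<lambda>(i, k). v k i)"
  define W where "W = mat n n (\<lambda>(k, i). cnj (v k i))"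
  define D where "D = mat n n (\<lambda>(k, l). if k = l then lam k else 0)"
  have car: "U \<in> carrier_mat n n" "W \<in> carrier_mat n n" "D \<in> carrier_mat n n"
    by (simp_all add: U_def W_def D_def)
  have WU: "W * U = 1\<^sub>m n"
    using v
    by (intro eq_matI)
       (auto simp: U_def W_def scalar_prod_def orthonormal_def cinner_def atLeast0LessThan)
  then have UW: "U * W = 1\<^sub>m n"
    using mat_mult_left_right_inverse[OF car(2,1)] by blast
  have "A * U = U * D"
  proof (rule eq_matI)
    fix i k assume "i < dim_row (U * D)" "k < dim_col (U * D)"
    then have ik: "i < n" "k < n" using car by auto
    then have "(A * U) $$ (i, k) = apply_mat n A (v k) i"
      using A by (simp add: U_def apply_mat_def scalar_prod_def atLeast0LessThan)
    moreover have "(U * D) $$ (i, k) = lam k * v k i"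
      using ik by (simp add: U_def D_def scalar_prod_def atLeast0LessThan if_distrib cong: if_cong)
    ultimately show "(A * U) $$ (i, k) = (U * D) $$ (i, k)"
      using ev ik by simp
  qed (use A car in auto)
  then have "A = U * D * W"
    using A car UW by (metis assoc_mult_mat right_mult_one_mat)
  then have "similar_mat A D"
    using A car UW WU by (intro similar_matI[of A D U W n]) auto
  then have "char_poly A = char_poly D"
    by (rule char_poly_similar)
  also have "\<dots> = (\<Prod>a\<leftarrow>diag_mat D. [:- a, 1:])"
    using car by (intro char_poly_upper_triangular) (auto simp: D_def)
  also have "diag_mat D = map lam [0..<n]"
    by (auto simp: diag_mat_def D_def)
  finally have "proots (char_poly A) = mset (map lam [0..<n])"
    by (simp only: proots_prod_linear)
  then show ?thesis
    by (simp add: eigvals_def multiset.map_comp o_def)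
qed

text \<open>
  The eigenvectors are reordered so that the \<open>k\<close>-th of them belongs to the \<open>k\<close>-th entry of
  the sorted list of eigenvalues.
\<close>

theorem spectral_decomposition:
  assumes A: "A \<in> Herm 2 n"
  obtains v where "orthonormal n n v"
    "\<And>i j. i < n \<Longrightarrow> j < n \<Longrightarrow>
       A $$ (i, j) = (\<Sum>k<n. of_real (eigvals A ! k) * v k i * cnj (v k j))"
proof -
  have c: "A \<in> carrier_mat n n"
    using A by (rule Herm_2_carrier)
  obtain v lam where v: "orthonormal n n v"
      "\<And>k i. k < n \<Longrightarrow> i < n \<Longrightarrow> apply_mat n A (v k) i = lam k * v k i"
    using ex_orthonormal_eigenvectors[OF A order_refl] by blast
  have real: "of_real (Re (lam k)) = lam k" if "k < n" for k
  proof -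
    have "cinner n (v k) (apply_mat n A (v k)) = cinner n (v k) (\<lambda>i. lam k * v k i)"
      using v(2) that by (intro cinner_cong) auto
    moreover have "cinner n (apply_mat n A (v k)) (v k) = cinner n (\<lambda>i. lam k * v k i) (v k)"
      using v(2) that by (intro cinner_cong) auto
    ultimately have "lam k = cnj (lam k)"
      using cinner_apply_mat_selfadjoint[OF A, of "v k" "v k"] v(1) that
      by (simp add: cinner_scale_left cinner_scale_right orthonormal_def)
    then show ?thesis
      by (metis complex_is_Real_iff Reals_cnj_iff of_real_Re)
  qed
  have "mset (eigvals A) = mset (map (\<lambda>k. Re (lam k)) [0..<n])"
    using mset_eigvals_eigenbasis[OF c v] by simp
  then obtain p where p: "p permutes {..<n}"
      "permute_list p (map (\<lambda>k. Re (lam k)) [0..<n]) = eigvals A"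
    using mset_eq_permutation[of "eigvals A" "map (\<lambda>k. Re (lam k)) [0..<n]"] by auto
  have eig: "eigvals A ! k = Re (lam (p k))" if "k < n" for k
    using permute_list_nth[of p "map (\<lambda>k. Re (lam k)) [0..<n]" k] p that
      permutes_in_image[OF p(1)] by simp
  show ?thesis
  proof
    have "p k < n" if "k < n" for k
      using permutes_in_image[OF p(1)] that by simp
    moreover have "p k = p l \<longleftrightarrow> k = l" for k l
      using permutes_inj[OF p(1)] by (simp add: inj_eq)
    ultimately show "orthonormal n n (v \<circ> p)"
      using v(1) by (simp add: orthonormal_def)
    fix i j assume ij: "i < n" "j < n"
    have "A $$ (i, j) = (\<Sum>l<n. A $$ (i, l) * of_bool (l = j))"
      using ij by (simp add: of_bool_def if_distrib cong: if_cong)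
    also have "\<dots> = (\<Sum>l<n. A $$ (i, l) * (\<Sum>k<n. v k l * cnj (v k j)))"
      using orthonormal_complete[OF v(1)] ij by simp
    also have "\<dots> = (\<Sum>l<n. \<Sum>k<n. A $$ (i, l) * v k l * cnj (v k j))"
      by (simp add: sum_distrib_left mult_ac)
    also have "\<dots> = (\<Sum>k<n. \<Sum>l<n. A $$ (i, l) * v k l * cnj (v k j))"
      by (rule sum.swap)
    also have "\<dots> = (\<Sum>k<n. apply_mat n A (v k) i * cnj (v k j))"
      by (simp add: apply_mat_def sum_distrib_right)
    also have "\<dots> = (\<Sum>k<n. of_real (Re (lam k)) * v k i * cnj (v k j))"
      using v(2) ij real by simp
    also have "\<dots> = (\<Sum>k<n. of_real (Re (lam (p k))) * v (p k) i * cnj (v (p k) j))"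
      by (rule sum.permute[OF p(1), unfolded o_def])
    finally show "A $$ (i, j) = (\<Sum>k<n. of_real (eigvals A ! k) * (v \<circ> p) k i * cnj ((v \<circ> p) k j))"
      by (simp add: eig)
  qed
qed

section \<open>Interlacing of eigenvalues\<close>

lemma cinner_apply_mat_eigenbasis:
  assumes "\<And>i j. i < n \<Longrightarrow> j < n \<Longrightarrow> A $$ (i, j) = (\<Sum>k<n. of_real (a k) * v k i * cnj (v k j))"
  shows "cinner n x (apply_mat n A x) = of_real (\<Sum>k<n. a k * (cmod (cinner n (v k) x))\<^sup>2)"
proof -
  have "cinner n x (apply_mat n A x) = (\<Sum>i<n. \<Sum>j<n. \<Sum>k<n. of_real (a k) * (cnj (x i) * v k i) * (cnj (v k j) * x j))"
    unfolding cinner_def apply_mat_def sum_distrib_left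
    by (intro sum.cong refl) (simp add: assms sum_distrib_left sum_distrib_right mult_ac)
  also have "\<dots> = (\<Sum>i<n. \<Sum>k<n. \<Sum>j<n. of_real (a k) * (cnj (x i) * v k i) * (cnj (v k j) * x j))"
    by (intro sum.cong refl sum.swap)
  also have "\<dots> = (\<Sum>k<n. \<Sum>i<n. \<Sum>j<n. of_real (a k) * (cnj (x i) * v k i) * (cnj (v k j) * x j))"
    by (rule sum.swap)
  also have "\<dots> = (\<Sum>k<n. of_real (a k) * (cnj (cinner n (v k) x) * cinner n (v k) x))"
    unfolding cnj_cinner unfolding cinner_def unfolding sum_product unfolding sum_distrib_left
    by (simp add: mult_ac)
  finally show ?thesis
    by (simp add: complex_norm_square mult_ac del: of_real_power)
qed

lemma eigvals_mono:
  assumes "A \<in> carrier_mat n n" "i \<le> j" "j < n"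
  shows "eigvals A ! i \<le> eigvals A ! j"
proof -
  have "sorted (eigvals A)"
    by (simp add: eigvals_def)
  then show ?thesis
    using assms length_eigvals[OF assms(1)] by (intro sorted_nth_mono) auto
qed

text \<open>
  The Courant--Fischer argument. Let \<open>x\<close> be orthogonal to the eigenvectors of \<open>A\<close> below index
  \<open>i\<close>, to those of \<open>B\<close> above index \<open>i + m\<close>, and to the \<open>m\<close> vectors \<open>u\<close>. These are only
  \<open>n - 1\<close> conditions, so such a unit vector exists, and the values of the two forms at \<open>x\<close> lie
  between the two eigenvalues. The case \<open>m = 0\<close> is monotonicity, the case \<open>m = 1\<close> is the other half of
  interlacing.
\<close>

lemma weyl_codimension:
  assumes A: "A \<in> Herm 2 n" and B: "B \<in> Herm 2 n" and im: "i + m < n"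
    and le: "\<And>x. (\<And>k. k < m \<Longrightarrow> cinner n (u k) x = 0) \<Longrightarrow>
               Re (cinner n x (apply_mat n A x)) \<le> Re (cinner n x (apply_mat n B x))"
  shows "eigvals A ! i \<le> eigvals B ! (i + m)"
proof -
  have car: "A \<in> carrier_mat n n" "B \<in> carrier_mat n n"
    using A B by (auto intro: Herm_2_carrier)
  obtain v where v: "orthonormal n n v"
      "\<And>i j. i < n \<Longrightarrow> j < n \<Longrightarrow>
         A $$ (i, j) = (\<Sum>k<n. of_real (eigvals A ! k) * v k i * cnj (v k j))"
    using spectral_decomposition[OF A] by blast
  obtain w where w: "orthonormal n n w"
      "\<And>i j. i < n \<Longrightarrow> j < n \<Longrightarrow>
         B $$ (i, j) = (\<Sum>k<n. of_real (eigvals B ! k) * w k i * cnj (w k j))"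
    using spectral_decomposition[OF B] by blast
  \<comment> \<open>the \<open>n - 1\<close> conditions; the index \<open>k + 1\<close> starts the vectors \<open>w\<close> just above \<open>i + m\<close>\<close>
  define c where "c k = (if k < i then v k else if k < i + m then u (k - i) else w (k + 1))" for k
  obtain x where x: "cinner n x x = 1" "\<forall>k<n - 1. cinner n (c k) x = 0"
    using ex_unit_orthogonal[of "n - 1" n c] im by auto
  have xv: "cinner n (v k) x = 0" if "k < i" for k
    using x(2) im that by (auto simp: c_def dest!: spec[of _ k])
  have xu: "cinner n (u k) x = 0" if "k < m" for k
    using x(2) im that by (auto simp: c_def dest!: spec[of _ "i + k"])
  have xw: "cinner n (w k) x = 0" if "i + m < k" "k < n" for k
  proof -
    have "\<not> k - 1 < i" "\<not> k - 1 < i + m" "k - 1 + 1 = k" "k - 1 < n - 1"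
      using that by auto
    then have "c (k - 1) = w k"
      unfolding c_def by simp
    then show ?thesis
      using x(2) \<open>k - 1 < n - 1\<close> by (auto dest: spec[of _ "k - 1"])
  qed
  have norm: "(\<Sum>k<n. (cmod (cinner n (z k) x))\<^sup>2) = 1" if "orthonormal n n z" for z
  proof -
    have "complex_of_real (\<Sum>k<n. (cmod (cinner n (z k) x))\<^sup>2) = of_real 1"
      unfolding parseval[OF that, of x, symmetric] x(1) by simp
    then show ?thesis
      by (simp only: of_real_eq_iff)
  qed
  note nv = norm[OF v(1)] and nw = norm[OF w(1)]
  have "eigvals A ! i = (\<Sum>k<n. eigvals A ! i * (cmod (cinner n (v k) x))\<^sup>2)"
    using nv by (simp flip: sum_distrib_left)
  also have "\<dots> \<le> (\<Sum>k<n. eigvals A ! k * (cmod (cinner n (v k) x))\<^sup>2)"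
  proof (intro sum_mono)
    fix k assume "k \<in> {..<n}"
    then show "eigvals A ! i * (cmod (cinner n (v k) x))\<^sup>2 \<le> eigvals A ! k * (cmod (cinner n (v k) x))\<^sup>2"
      using xv[of k] eigvals_mono[OF car(1), of i k] by (cases "k < i") (auto intro: mult_right_mono)
  qed
  also have "\<dots> = Re (cinner n x (apply_mat n A x))"
    by (subst cinner_apply_mat_eigenbasis[of n A _ v, OF v(2)]) simp_all
  also have "\<dots> \<le> Re (cinner n x (apply_mat n B x))"
    by (rule le) (rule xu)
  also have "\<dots> = (\<Sum>k<n. eigvals B ! k * (cmod (cinner n (w k) x))\<^sup>2)"
    by (subst cinner_apply_mat_eigenbasis[of n B _ w, OF w(2)]) simp_all
  also have "\<dots> \<le> (\<Sum>k<n. eigvals B ! (i + m) * (cmod (cinner n (w k) x))\<^sup>2)"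
  proof (intro sum_mono)
    fix k assume "k \<in> {..<n}"
    then show "eigvals B ! k * (cmod (cinner n (w k) x))\<^sup>2 \<le> eigvals B ! (i + m) * (cmod (cinner n (w k) x))\<^sup>2"
      using xw[of k] eigvals_mono[OF car(2), of k "i + m"] im
      by (cases "i + m < k") (auto intro: mult_right_mono)
  qed
  also have "\<dots> = eigvals B ! (i + m)"
    using nw by (simp flip: sum_distrib_left)
  finally show ?thesis .
qed

lemma trace_eq_sum_eigvals:
  assumes "A \<in> Herm 2 n"
  shows "(\<Sum>i<n. A $$ (i, i)) = of_real (\<Sum>k<n. eigvals A ! k)"
proof -
  obtain v where v: "orthonormal n n v"
      "\<And>i j. i < n \<Longrightarrow> j < n \<Longrightarrow>
         A $$ (i, j) = (\<Sum>k<n. of_real (eigvals A ! k) * v k i * cnj (v k j))"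
    using spectral_decomposition[OF assms] by blast
  have "(\<Sum>i<n. A $$ (i, i)) = (\<Sum>i<n. \<Sum>k<n. of_real (eigvals A ! k) * (cnj (v k i) * v k i))"
    by (simp add: v(2) mult_ac)
  also have "\<dots> = (\<Sum>k<n. of_real (eigvals A ! k) * cinner n (v k) (v k))"
    unfolding cinner_def sum_distrib_left by (rule sum.swap)
  also have "\<dots> = (\<Sum>k<n. of_real (eigvals A ! k))"
    using v(1) by (simp add: orthonormal_def)
  finally show ?thesis by simp
qed

definition rank_one :: "nat \<Rightarrow> real \<Rightarrow> (nat \<Rightarrow> complex) \<Rightarrow> complex mat" where
  "rank_one n c u = mat n n (\<lambda>(i, j). of_real c * u i * cnj (u j))"

lemma rank_one_carrier [simp]: "rank_one n c u \<in> carrier_mat n n"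
  by (simp add: rank_one_def)

lemma Herm_2_add_rank_one:
  assumes "A \<in> Herm 2 n"
  shows "A + rank_one n c u \<in> Herm 2 n"
proof -
  show ?thesis
    using Herm_2_carrier[OF assms] Herm_2_cnj[OF assms]
    by (auto simp: Herm_2_iff rank_one_def mult_ac)
qed

lemma quadratic_form_add_rank_one:
  assumes "A \<in> carrier_mat n n"
  shows "cinner n x (apply_mat n (A + rank_one n c u) x) =
         cinner n x (apply_mat n A x) + of_real (c * (cmod (cinner n u x))\<^sup>2)"
proof -
  have "cinner n x (apply_mat n (A + rank_one n c u) x) =
        (\<Sum>i<n. \<Sum>j<n. cnj (x i) * (A $$ (i, j) * x j)) +
        of_real c * (\<Sum>i<n. \<Sum>j<n. (cnj (x i) * u i) * (cnj (u j) * x j))"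
    unfolding cinner_def apply_mat_def sum_distrib_left sum.distrib[symmetric]
    using assms by (intro sum.cong refl) (simp add: rank_one_def algebra_simps)
  also have "(\<Sum>i<n. \<Sum>j<n. (cnj (x i) * u i) * (cnj (u j) * x j)) = cnj (cinner n u x) * cinner n u x"
    unfolding cnj_cinner unfolding cinner_def sum_product ..
  finally show ?thesis
    by (simp add: cinner_def apply_mat_def sum_distrib_left complex_norm_square mult_ac del: of_real_power)
qed

text \<open>
  A nonnegative rank-one perturbation increases the quadratic form and leaves it unchanged on the
  hyperplane orthogonal to \<open>u\<close>, which gives the two halves; the last equation compares traces.
\<close>

lemma rank_one_interlacing:
  assumes A: "A \<in> Herm 2 n" and c: "c \<ge> 0" and u: "cinner n u u = 1"
  defines "B \<equiv> A + rank_one n c u"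
  shows "\<And>i. i < n \<Longrightarrow> eigvals A ! i \<le> eigvals B ! i"
    and "\<And>i. Suc i < n \<Longrightarrow> eigvals B ! i \<le> eigvals A ! Suc i"
    and "(\<Sum>i<n. eigvals B ! i) = (\<Sum>i<n. eigvals A ! i) + c"
proof -
  have B: "B \<in> Herm 2 n"
    unfolding B_def by (rule Herm_2_add_rank_one[OF A])
  have car: "A \<in> carrier_mat n n"
    using A by (rule Herm_2_carrier)
  note q = quadratic_form_add_rank_one[OF car, of _ c u, folded B_def]
  show "eigvals A ! i \<le> eigvals B ! i" if "i < n" for i
    using weyl_codimension[OF A B, of i 0] that c by (simp add: q)
  show "eigvals B ! i \<le> eigvals A ! Suc i" if "Suc i < n" for i
    using weyl_codimension[OF B A, of i 1 "\<lambda>_. u"] that by (simp add: q)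
  have "complex_of_real (\<Sum>i<n. eigvals B ! i) = (\<Sum>i<n. A $$ (i, i) + of_real c * u i * cnj (u i))"
    unfolding trace_eq_sum_eigvals[OF B, symmetric]
    using car by (intro sum.cong) (auto simp: B_def rank_one_def)
  also have "\<dots> = (\<Sum>i<n. A $$ (i, i)) + of_real c * cinner n u u"
    by (simp add: sum.distrib cinner_def sum_distrib_left mult_ac)
  also have "\<dots> = of_real ((\<Sum>i<n. eigvals A ! i) + c)"
    by (simp add: trace_eq_sum_eigvals[OF A] u)
  finally show "(\<Sum>i<n. eigvals B ! i) = (\<Sum>i<n. eigvals A ! i) + c"
    by (simp only: of_real_eq_iff)
qed

section \<open>Concavity of powers\<close>

text \<open>
  Concavity of the power function, stated for its increments. The derivative of the increment is
  used on the open interval only, which allows \<open>s = 0\<close>.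
\<close>

lemma powr_increment_antimono:
  fixes p :: real
  assumes "0 < p" "p < 1" "0 \<le> s" "s \<le> y" "0 \<le> d"
  shows "(y + d) powr p - y powr p \<le> (s + d) powr p - s powr p"
proof (rule DERIV_nonpos_imp_decreasing_open[OF assms(4)])
  fix x assume x: "s < x" "x < y"
  have "((\<lambda>x. (x + d) powr p - x powr p) has_real_derivative
          p * (x + d) powr (p - 1) - p * x powr (p - 1)) (at x)"
    using x assms by (auto intro!: derivative_eq_intros)
  moreover have "(x + d) powr (p - 1) \<le> x powr (p - 1)"
    using x assms by (intro powr_mono2') auto
  ultimately show "\<exists>D. ((\<lambda>x. (x + d) powr p - x powr p) has_real_derivative D) (at x) \<and> D \<le> 0"
    using assms(1) by (intro exI conjI) auto
next
  show "continuous_on {s..y} (\<lambda>x. (x + d) powr p - x powr p)"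
    using assms by (intro continuous_intros continuous_on_powr') auto
qed

definition trunc_powr :: "real \<Rightarrow> real \<Rightarrow> real \<Rightarrow> real" where
  "trunc_powr p t x = (max (t - x) 0) powr p"

text \<open>
  The positive parts \<open>max (t - a i) 0\<close> and \<open>max (t - b i) 0\<close> bound disjoint intervals of the
  positive axis, the one with index \<open>0\<close> being rightmost. By induction the intervals of positive
  index are already packed into an initial segment of length \<open>L\<close>; it ends before the interval
  of index \<open>0\<close> begins, so by concavity moving that interval left to start at \<open>L\<close> can only increase
  its contribution. The bound of the total length by \<open>max (t - a 0) 0\<close> carries this through the
  induction.
\<close>

lemma interlacing_powr_aux:
  fixes a b :: "nat \<Rightarrow> real" and t :: real
  assumes p: "0 < p" "p < 1"
    and "\<And>i. i < n \<Longrightarrow> a i \<le> b i" and "\<And>i. Suc i < n \<Longrightarrow> b i \<le> a (Suc i)"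
  defines "\<delta> \<equiv> \<lambda>a b i. max (t - a i) 0 - max (t - b i) (0 :: real)"
  shows "0 \<le> (\<Sum>i<n. \<delta> a b i) \<and> (n > 0 \<longrightarrow> (\<Sum>i<n. \<delta> a b i) \<le> max (t - a 0) 0) \<and>
     (\<Sum>i<n. trunc_powr p t (a i) - trunc_powr p t (b i)) \<le> (\<Sum>i<n. \<delta> a b i) powr p"
  using assms(3,4)
proof (induction n arbitrary: a b)
  case 0
  then show ?case by simp
next
  case (Suc n)
  define L where "L = (\<Sum>i<n. \<delta> (\<lambda>i. a (Suc i)) (\<lambda>i. b (Suc i)) i)"
  define S where "S = (\<Sum>i<n. trunc_powr p t (a (Suc i)) - trunc_powr p t (b (Suc i)))"
  define x y where "x = max (t - a 0) 0" and "y = max (t - b 0) 0"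
  have IH: "0 \<le> L" "n > 0 \<longrightarrow> L \<le> max (t - a 1) 0" "S \<le> L powr p"
    using Suc.IH[of "\<lambda>i. a (Suc i)" "\<lambda>i. b (Suc i)"] Suc.prems by (auto simp: L_def S_def)
  have "y \<le> x"
    using Suc.prems(1)[of 0] by (auto simp: x_def y_def)
  have "L \<le> y"
  proof (cases "n = 0")
    case True
    then show ?thesis by (simp add: L_def y_def)
  next
    case False
    then show ?thesis using IH(2) Suc.prems(2)[of 0] by (simp add: y_def)
  qed
  have sum_\<delta>: "(\<Sum>i<Suc n. \<delta> a b i) = L + (x - y)"
    unfolding sum.lessThan_Suc_shift by (simp add: L_def \<delta>_def x_def y_def)
  have sum_powr: "(\<Sum>i<Suc n. trunc_powr p t (a i) - trunc_powr p t (b i)) = x powr p - y powr p + S"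
    unfolding sum.lessThan_Suc_shift by (simp add: S_def trunc_powr_def x_def y_def)
  have "x powr p - y powr p \<le> (L + (x - y)) powr p - L powr p"
    using powr_increment_antimono[OF p, of L y "x - y"] IH(1) \<open>L \<le> y\<close> \<open>y \<le> x\<close> by simp
  then show ?case
    unfolding sum_\<delta> sum_powr using IH \<open>L \<le> y\<close> \<open>y \<le> x\<close> by (auto simp: x_def)
qed

lemma interlacing_powr:
  fixes a b :: "nat \<Rightarrow> real"
  assumes p: "0 < p" "p < 1"
    and ab: "\<And>i. i < n \<Longrightarrow> a i \<le> b i" and ba: "\<And>i. Suc i < n \<Longrightarrow> b i \<le> a (Suc i)"
  shows "\<bar>(\<Sum>i<n. trunc_powr p t (a i)) - (\<Sum>i<n. trunc_powr p t (b i))\<bar> \<le> (\<Sum>i<n. b i - a i) powr p"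
proof -
  let ?D = "\<Sum>i<n. max (t - a i) 0 - max (t - b i) 0"
  have D: "0 \<le> ?D" "(\<Sum>i<n. trunc_powr p t (a i) - trunc_powr p t (b i)) \<le> ?D powr p"
    using interlacing_powr_aux[where a = a and b = b and n = n and t = t, OF p ab ba] by auto
  have "?D \<le> (\<Sum>i<n. b i - a i)"
  proof (intro sum_mono)
    fix i assume "i \<in> {..<n}"
    then show "max (t - a i) 0 - max (t - b i) 0 \<le> b i - a i"
      using ab[of i] by auto
  qed
  then have "?D powr p \<le> (\<Sum>i<n. b i - a i) powr p"
    using D(1) p(1) by (intro powr_mono2) auto
  moreover have "trunc_powr p t (b i) \<le> trunc_powr p t (a i)" if "i < n" for i
    unfolding trunc_powr_def using ab[OF that] p(1) by (intro powr_mono2) auto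
  then have "(\<Sum>i<n. trunc_powr p t (b i)) \<le> (\<Sum>i<n. trunc_powr p t (a i))"
    by (intro sum_mono) auto
  ultimately show ?thesis
    using D(2) by (simp add: sum_subtractf)
qed

section \<open>Truncated power traces under perturbation\<close>

definition trunc_trace :: "real \<Rightarrow> nat \<Rightarrow> real \<Rightarrow> complex mat \<Rightarrow> real" where
  "trunc_trace p n t A = (\<Sum>i<n. trunc_powr p t (eigvals A ! i))"

lemma trunc_trace_rank_one:
  assumes p: "0 < p" "p < 1" and A: "A \<in> Herm 2 n" and u: "cinner n u u = 1"
  shows "\<bar>trunc_trace p n t (A + rank_one n c u) - trunc_trace p n t A\<bar> \<le> \<bar>c\<bar> powr p"
proof -
  have nonneg: "\<bar>trunc_trace p n t (B + rank_one n d u) - trunc_trace p n t B\<bar> \<le> d powr p"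
    if "B \<in> Herm 2 n" "d \<ge> 0" for B d
  proof -
    note il = rank_one_interlacing[OF that(1,2) u]
    have "\<bar>trunc_trace p n t B - trunc_trace p n t (B + rank_one n d u)\<bar>
        \<le> (\<Sum>i<n. eigvals (B + rank_one n d u) ! i - eigvals B ! i) powr p"
      unfolding trunc_trace_def by (intro interlacing_powr p il)
    then show ?thesis
      using il(3) by (simp add: sum_subtractf abs_minus_commute)
  qed
  show ?thesis
  proof (cases "c \<ge> 0")
    case True
    then show ?thesis using nonneg[OF A] by simp
  next
    case False
    have "A + rank_one n c u + rank_one n (- c) u = A"
      using Herm_2_carrier[OF A] by (intro eq_matI) (auto simp: rank_one_def)
    then show ?thesis
      using nonneg[OF Herm_2_add_rank_one[OF A], of "- c" c u] False
      by (simp add: abs_minus_commute)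
  qed
qed

text \<open>
  The perturbation is added one summand at a time. Every intermediate matrix is Hermitian, so the
  rank-one bound applies to each step.
\<close>

lemma trunc_trace_sum_rank_one:
  assumes p: "0 < p" "p < 1" and A: "A \<in> Herm 2 n"
    and "finite I" and u: "\<And>k. k \<in> I \<Longrightarrow> cinner n (u k) (u k) = 1"
    and "B \<in> carrier_mat n n"
    and "\<And>i j. i < n \<Longrightarrow> j < n \<Longrightarrow>
           B $$ (i, j) = A $$ (i, j) + (\<Sum>k\<in>I. of_real (c k) * u k i * cnj (u k j))"
  shows "\<bar>trunc_trace p n t B - trunc_trace p n t A\<bar> \<le> (\<Sum>k\<in>I. \<bar>c k\<bar> powr p)"
proof -
  have car: "A \<in> carrier_mat n n"
    using A by (rule Herm_2_carrier)
  define P where "P J = mat n n (\<lambda>(i, j). A $$ (i, j) + (\<Sum>k\<in>J. of_real (c k) * u k i * cnj (u k j)))" for J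
  have "P I \<in> Herm 2 n \<and> \<bar>trunc_trace p n t (P I) - trunc_trace p n t A\<bar> \<le> (\<Sum>k\<in>I. \<bar>c k\<bar> powr p)"
    using \<open>finite I\<close> u
  proof (induction I rule: finite_induct)
    case empty
    have "P {} = A"
      using car by (intro eq_matI) (auto simp: P_def)
    then show ?case using A by simp
  next
    case (insert k I)
    have step: "P (insert k I) = P I + rank_one n (c k) (u k)"
      using insert.hyps by (intro eq_matI) (auto simp: P_def rank_one_def)
    have IH: "P I \<in> Herm 2 n" "\<bar>trunc_trace p n t (P I) - trunc_trace p n t A\<bar> \<le> (\<Sum>k\<in>I. \<bar>c k\<bar> powr p)"
      using insert by auto
    have "\<bar>trunc_trace p n t (P (insert k I)) - trunc_trace p n t (P I)\<bar> \<le> \<bar>c k\<bar> powr p"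
      unfolding step using trunc_trace_rank_one[OF p IH(1)] insert.prems by simp
    then show ?case
      using IH Herm_2_add_rank_one[OF IH(1)] insert.hyps by (simp add: step)
  qed
  moreover have "P I = B"
    using assms(6,7) by (intro eq_matI) (auto simp: P_def)
  ultimately show ?thesis by simp
qed

lemma Herm_2_minus:
  assumes "A \<in> Herm 2 n" "B \<in> Herm 2 n"
  shows "A - B \<in> Herm 2 n"
proof -
  show ?thesis
    using assms[THEN Herm_2_carrier] Herm_2_cnj[OF assms(1)] Herm_2_cnj[OF assms(2)]
    by (auto simp: Herm_2_iff)
qed

theorem trunc_trace_diff_le_eigvals:
  assumes p: "0 < p" "p < 1" and A: "A \<in> Herm 2 n" and B: "B \<in> Herm 2 n"
  shows "\<bar>trunc_trace p n t A - trunc_trace p n t B\<bar> \<le> (\<Sum>k<n. \<bar>eigvals (A - B) ! k\<bar> powr p)"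
proof -
  obtain v where v: "orthonormal n n v"
      "\<And>i j. i < n \<Longrightarrow> j < n \<Longrightarrow>
         (A - B) $$ (i, j) = (\<Sum>k<n. of_real (eigvals (A - B) ! k) * v k i * cnj (v k j))"
    using spectral_decomposition[OF Herm_2_minus[OF A B]] by blast
  have car: "A \<in> carrier_mat n n" "B \<in> carrier_mat n n"
    using A B by (auto intro: Herm_2_carrier)
  show ?thesis
  proof (rule trunc_trace_sum_rank_one[OF p B _ _ car(1)])
    show "A $$ (i, j) = B $$ (i, j) + (\<Sum>k<n. of_real (eigvals (A - B) ! k) * v k i * cnj (v k j))"
      if "i < n" "j < n" for i j
      using v(2)[OF that] car that by (simp add: algebra_simps)
  qed (use v(1) in \<open>auto simp: orthonormal_def\<close>)
qed

text \<open>
  For a Hermitian matrix \<open>D\<close> and \<open>a < b\<close> put \<open>\<phi> = D\<^sub>a\<^sub>b / \<bar>D\<^sub>a\<^sub>b\<bar>\<close>, and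
  \<open>\<phi> = 1\<close> for a zero entry, which keeps the following vectors normalized. With the unit vectors
  \<open>u = (\<phi> e\<^sub>a + e\<^sub>b) / \<surd>2\<close> and \<open>w = (\<phi> e\<^sub>a - e\<^sub>b) / \<surd>2\<close>, the part of \<open>D\<close> at the positions
  \<open>(a, b)\<close> and \<open>(b, a)\<close> is \<open>\<bar>D\<^sub>a\<^sub>b\<bar> (u u\<^sup>* - w w\<^sup>*)\<close>. The summand with \<open>u\<close> is attached to the index
  \<open>(a, b)\<close> and the one with \<open>w\<close> to \<open>(b, a)\<close>, so that the weights match the entries in modulus.
\<close>

definition phase :: "complex \<Rightarrow> complex" where
  "phase w = (if w = 0 then 1 else sgn w)"

definition entry_vec :: "complex mat \<Rightarrow> nat \<times> nat \<Rightarrow> nat \<Rightarrow> complex" where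
  "entry_vec D = (\<lambda>(a, b) i.
     if a = b then of_bool (i = a)
     else if a < b then (phase (D $$ (a, b)) * of_bool (i = a) + of_bool (i = b)) / of_real (sqrt 2)
     else (phase (D $$ (b, a)) * of_bool (i = b) - of_bool (i = a)) / of_real (sqrt 2))"

definition entry_coeff :: "complex mat \<Rightarrow> nat \<times> nat \<Rightarrow> real" where
  "entry_coeff D = (\<lambda>(a, b).
     if a = b then Re (D $$ (a, a)) else if a < b then cmod (D $$ (a, b)) else - cmod (D $$ (b, a)))"

lemma phase_mult_cnj: "phase w * cnj (phase w) = 1"
  by (simp add: phase_def complex_norm_square[symmetric] norm_sgn)

lemma cmod_mult_phase: "of_real (cmod w) * phase w = w"
  by (simp add: phase_def sgn_eq)

lemma sqrt2_mult_sqrt2: "complex_of_real (sqrt 2) * complex_of_real (sqrt 2) = 2"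
  by (simp flip: of_real_mult)

lemma entry_vec_unit:
  assumes "a < n" "b < n"
  shows "cinner n (entry_vec D (a, b)) (entry_vec D (a, b)) = 1"
proof -
  have two: "cinner n (\<lambda>i. (\<alpha> * of_bool (i = c) + \<beta> * of_bool (i = d)) / of_real (sqrt 2))
               (\<lambda>i. (\<alpha> * of_bool (i = c) + \<beta> * of_bool (i = d)) / of_real (sqrt 2)) = 1"
    if "c < n" "d < n" "c \<noteq> d" "\<alpha> * cnj \<alpha> = 1" "\<beta> * cnj \<beta> = 1" for \<alpha> \<beta> c d
  proof -
    have "cnj ((\<alpha> * of_bool (i = c) + \<beta> * of_bool (i = d)) / of_real (sqrt 2)) *
          ((\<alpha> * of_bool (i = c) + \<beta> * of_bool (i = d)) / of_real (sqrt 2)) =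
          of_bool (i = c) / 2 + of_bool (i = d) / 2" for i
      using that by (auto simp: sqrt2_mult_sqrt2 mult.commute)
    then show ?thesis
      using that unfolding cinner_def by (simp add: sum.distrib flip: sum_divide_distrib)
  qed
  consider "a = b" | "a < b" | "b < a" by linarith
  then show ?thesis
  proof cases
    case 1
    then show ?thesis using assms by (simp add: entry_vec_def cinner_def)
  next
    case 2
    then show ?thesis
      using two[of a b "phase (D $$ (a, b))" 1] assms phase_mult_cnj by (simp add: entry_vec_def)
  next
    case 3
    then show ?thesis
      using two[of b a "phase (D $$ (b, a))" "- 1"] assms phase_mult_cnj by (simp add: entry_vec_def)
  qed
qed

lemma entry_rank_one_sym:
  assumes D: "D \<in> Herm 2 n" and ab: "a < n" "b < n"
  defines "T \<equiv> \<lambda>k i j. of_real (entry_coeff D k) * entry_vec D k i * cnj (entry_vec D k j)"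
  shows "T (a, b) i j + T (b, a) i j =
         D $$ (a, b) * of_bool (i = a \<and> j = b) + D $$ (b, a) * of_bool (i = b \<and> j = a)"
proof -
  have less: "T (c, d) i j + T (d, c) i j =
         D $$ (c, d) * of_bool (i = c \<and> j = d) + D $$ (d, c) * of_bool (i = d \<and> j = c)"
    if cd: "c < d" "d < n" for c d
  proof -
    define w where "w = D $$ (c, d)"
    have w': "D $$ (d, c) = cnj w"
      unfolding w_def using cd Herm_2_cnj[OF D, of d c] by simp
    let ?e = "\<lambda>k l. of_bool (l = k) :: complex"
    have "T (c, d) i j + T (d, c) i j =
        of_real (cmod w) * ((phase w * ?e c i + ?e d i) * (cnj (phase w) * ?e c j + ?e d j)
          - (phase w * ?e c i - ?e d i) * (cnj (phase w) * ?e c j - ?e d j)) / 2"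
      using cd by (simp add: T_def entry_vec_def entry_coeff_def flip: w_def)
        (simp add: field_simps sqrt2_mult_sqrt2)
    also have "\<dots> = (of_real (cmod w) * phase w) * ?e c i * ?e d j
        + cnj (of_real (cmod w) * phase w) * ?e d i * ?e c j"
      by (simp add: algebra_simps)
    also have "\<dots> = w * of_bool (i = c \<and> j = d) + cnj w * of_bool (i = d \<and> j = c)"
      unfolding cmod_mult_phase of_bool_conj mult.assoc ..
    finally show ?thesis
      unfolding w' w_def[symmetric] .
  qed
  consider "a = b" | "a < b" | "b < a" by linarith
  then show ?thesis
  proof cases
    case 1
    have "D $$ (a, a) = of_real (Re (D $$ (a, a)))"
      using arg_cong[OF Herm_2_cnj[OF D ab(1,1)], of Im] by (simp add: complex_eq_iff)
    with 1 show ?thesis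
      by (simp add: T_def entry_vec_def entry_coeff_def)
  next
    case 2
    then show ?thesis using less ab by simp
  next
    case 3
    then show ?thesis using less[of b a] ab by (simp add: add.commute)
  qed
qed

text \<open>
  A single summand is not supported at its own index, only the sum of the summands at
  \<open>(a, b)\<close> and \<open>(b, a)\<close> is. Hence the total is evaluated as half of its symmetrization.
\<close>

lemma entry_decomposition:
  assumes D: "D \<in> Herm 2 n" and ij: "i < n" "j < n"
  shows "D $$ (i, j) = (\<Sum>k\<in>{..<n} \<times> {..<n}.
           of_real (entry_coeff D k) * entry_vec D k i * cnj (entry_vec D k j))"
proof -
  define T where "T k = of_real (entry_coeff D k) * entry_vec D k i * cnj (entry_vec D k j)" for k
  have "2 * (\<Sum>k\<in>{..<n} \<times> {..<n}. T k) =
        (\<Sum>a<n. \<Sum>b<n. T (a, b)) + (\<Sum>b<n. \<Sum>a<n. T (a, b))"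
    by (subst (2) sum.swap) (simp add: sum.cartesian_product)
  also have "\<dots> = (\<Sum>a<n. \<Sum>b<n. T (a, b) + T (b, a))"
    by (simp add: sum.distrib)
  also have "\<dots> = (\<Sum>a<n. \<Sum>b<n. D $$ (a, b) * of_bool (i = a \<and> j = b)
                                  + D $$ (b, a) * of_bool (i = b \<and> j = a))"
    unfolding T_def using entry_rank_one_sym[OF D] by (intro sum.cong refl) auto
  also have "\<dots> = 2 * D $$ (i, j)"
  proof -
    have delta: "(\<Sum>a<n. \<Sum>b<n. f a b * of_bool (i = a \<and> j = b)) = f i j" for f :: "nat \<Rightarrow> nat \<Rightarrow> complex"
    proof -
      have "(\<Sum>b<n. f a b * of_bool (i = a \<and> j = b)) = (if i = a then f a j else 0)" for a
        using ij by (cases "i = a") (simp_all add: of_bool_def if_distrib cong: if_cong)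
      then show ?thesis using ij by simp
    qed
    have swapped: "(\<Sum>a<n. \<Sum>b<n. D $$ (b, a) * of_bool (i = b \<and> j = a)) = D $$ (i, j)"
      by (subst sum.swap) (rule delta)
    show ?thesis
      by (simp only: sum.distrib delta[of "\<lambda>a b. D $$ (a, b)"] swapped mult_2)
  qed
  finally show ?thesis by (simp add: T_def)
qed

theorem trunc_trace_diff_le_entries:
  assumes p: "0 < p" "p < 1" and A: "A \<in> Herm 2 n" and B: "B \<in> Herm 2 n"
  shows "\<bar>trunc_trace p n t A - trunc_trace p n t B\<bar> \<le> lp_norm_powr p (A - B)"
proof -
  define D where "D = A - B"
  have D: "D \<in> Herm 2 n"
    unfolding D_def by (rule Herm_2_minus[OF A B])
  have car: "A \<in> carrier_mat n n" "B \<in> carrier_mat n n" "D \<in> carrier_mat n n"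
    using A B D by (auto intro: Herm_2_carrier)
  have "\<bar>trunc_trace p n t A - trunc_trace p n t B\<bar> \<le>
      (\<Sum>k\<in>{..<n} \<times> {..<n}. \<bar>entry_coeff D k\<bar> powr p)"
  proof (rule trunc_trace_sum_rank_one[OF p B _ _ car(1)])
    show "A $$ (i, j) = B $$ (i, j) + (\<Sum>k\<in>{..<n} \<times> {..<n}.
           of_real (entry_coeff D k) * entry_vec D k i * cnj (entry_vec D k j))"
      if "i < n" "j < n" for i j
      using entry_decomposition[OF D that] car that by (simp add: D_def algebra_simps)
  qed (use entry_vec_unit in auto)
  also have "\<dots> \<le> (\<Sum>(a, b)\<in>{..<n} \<times> {..<n}. cmod (D $$ (a, b)) powr p)"
  proof (intro sum_mono)
    fix k assume "k \<in> {..<n} \<times> {..<n}"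
    then obtain a b where k: "k = (a, b)" "a < n" "b < n" by auto
    have "cmod (D $$ (b, a)) = cmod (D $$ (a, b))"
      using Herm_2_cnj[OF D k(2,3)] complex_mod_cnj[of "D $$ (b, a)"] by simp
    then have "\<bar>entry_coeff D k\<bar> \<le> cmod (D $$ (a, b))"
      using abs_Re_le_cmod[of "D $$ (a, a)"] by (auto simp: entry_coeff_def k(1))
    then show "\<bar>entry_coeff D k\<bar> powr p \<le> (case k of (a, b) \<Rightarrow> cmod (D $$ (a, b)) powr p)"
      using p(1) by (auto simp: k(1) intro: powr_mono2)
  qed
  also have "\<dots> = lp_norm_powr p D"
    unfolding lp_norm_powr_def sum.cartesian_product using car(3) by simp
  finally show ?thesis
    by (simp only: D_def)
qed

section \<open>Resolvents as superpositions of truncated powers\<close>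

text \<open>
  Up to a constant factor, the function of \<open>t\<close> whose fractional integral of order \<open>p + 1\<close>, from \<open>x\<close>
  to infinity, is the Cauchy kernel \<open>1 / (z - x)\<close>. For \<open>Im z > 0\<close> the number \<open>t - z\<close> stays in the
  lower half plane, away from the branch cut.
\<close>

definition frac_kernel :: "real \<Rightarrow> complex \<Rightarrow> real \<Rightarrow> complex" where
  "frac_kernel p z t = (of_real t - z) powr (- of_real (p + 2))"

lemma integrable_cauchy_density: "integrable lborel (\<lambda>t::real. 1 / (4 + (t - a)\<^sup>2))" (is ?i)
  and integral_cauchy_density: "(\<integral>t. 1 / (4 + (t - a)\<^sup>2) \<partial>lborel) = pi / 2" (is ?e)
proof -
  have std: "integrable lborel (\<lambda>x::real. inverse (1 + x\<^sup>2))" "(\<integral>x. inverse (1 + x\<^sup>2) \<partial>lborel) = pi"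
    using integrable_inverse_1_plus_square LBINT_inverse_1_plus_square
    by (simp_all add: set_integrable_def interval_lebesgue_integral_def set_lebesgue_integral_def)
  have scale: "1 / (4 + (a + 2 * x - a)\<^sup>2) = inverse (1 + x\<^sup>2) / 4" for x :: real
    by (simp add: power_mult_distrib field_simps)
  have "integrable lborel (\<lambda>x. 1 / (4 + (a + 2 * x - a)\<^sup>2))"
    unfolding scale using std(1) by simp
  then show ?i
    by (subst (asm) lborel_integrable_real_affine_iff[of 2]) auto
  have "(\<integral>t. 1 / (4 + (t - a)\<^sup>2) \<partial>lborel) = 2 * (\<integral>x. 1 / (4 + (a + 2 * x - a)\<^sup>2) \<partial>lborel)"
    by (subst lborel_integral_real_affine[of 2 _ a]) auto
  then show ?e
    unfolding scale using std(2) by simp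
qed

context
  fixes p :: real and z :: complex
  assumes p: "0 < p" and z: "2 \<le> Im z"
begin

lemma denominator_nonzero: "complex_of_real t - z \<noteq> 0"
  and denominator_not_nonpos: "complex_of_real t - z \<notin> \<real>\<^sub>\<le>\<^sub>0"
  and two_le_cmod_denominator: "2 \<le> cmod (complex_of_real t - z)"
proof -
  show "2 \<le> cmod (complex_of_real t - z)"
    using abs_Im_le_cmod[of "complex_of_real t - z"] z by simp
  then show "complex_of_real t - z \<noteq> 0" by auto
  show "complex_of_real t - z \<notin> \<real>\<^sub>\<le>\<^sub>0"
    using z by (auto simp: complex_nonpos_Reals_iff)
qed

lemma cauchy_bound: "1 / (cmod (of_real t - z))\<^sup>2 \<le> 1 / (4 + (t - Re z)\<^sup>2)"
proof -
  have "2\<^sup>2 \<le> (Im z)\<^sup>2"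
    using z by (intro power_mono) auto
  then show ?thesis
    by (intro frac_le) (auto simp: cmod_power2 intro!: add_pos_nonneg)
qed

lemma norm_frac_kernel: "cmod (frac_kernel p z t) = cmod (of_real t - z) powr (- p) / (cmod (of_real t - z))\<^sup>2"
proof -
  have "cmod (frac_kernel p z t) = cmod (of_real t - z) powr (- p - 2)"
    unfolding frac_kernel_def by (subst norm_powr_real_powr') (auto simp: algebra_simps)
  also have "\<dots> = cmod (of_real t - z) powr (- p) / (cmod (of_real t - z))\<^sup>2"
    using denominator_nonzero[of t] by (simp add: powr_diff powr_numeral)
  finally show ?thesis .
qed

lemma norm_frac_kernel_le: "cmod (frac_kernel p z t) \<le> 1 / (4 + (t - Re z)\<^sup>2)"
proof -
  have "cmod (of_real t - z) powr (- p) \<le> cmod (of_real t - z) powr 0"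
    using two_le_cmod_denominator[of t] p by (intro powr_mono) auto
  then have "cmod (frac_kernel p z t) \<le> 1 / (cmod (of_real t - z))\<^sup>2"
    unfolding norm_frac_kernel using denominator_nonzero[of t] by (intro divide_right_mono) auto
  then show ?thesis
    using cauchy_bound order_trans by blast
qed

lemma frac_kernel_measurable [measurable]: "frac_kernel p z \<in> borel_measurable borel"
  unfolding frac_kernel_def
  by (intro borel_measurable_continuous_onI continuous_on_powr_complex continuous_intros)
     (use z in auto)

lemma integrable_frac_kernel: "integrable lborel (\<lambda>t. cmod (frac_kernel p z t))"
  by (rule Bochner_Integration.integrable_bound[OF integrable_cauchy_density[of "Re z"]])
     (use norm_frac_kernel_le in \<open>auto simp: abs_of_pos\<close>)

lemma integral_norm_frac_kernel_le: "(\<integral>t. cmod (frac_kernel p z t) \<partial>lborel) \<le> pi / 2"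
  unfolding integral_cauchy_density[of "Re z", symmetric]
  by (intro integral_mono integrable_frac_kernel integrable_cauchy_density norm_frac_kernel_le)

text \<open>
  The factor \<open>(t - x)\<^sub>+\<^sup>p\<close> is at most a constant times \<open>\<bar>t - z\<bar>\<^sup>p\<close>, because \<open>\<bar>t - z\<bar>\<close>
  is bounded away from \<open>0\<close>. What remains decays like \<open>t\<^sup>-\<^sup>2\<close>.
\<close>

lemma integrable_trunc_powr_kernel:
  "integrable lborel (\<lambda>t. of_real (trunc_powr p t x) * frac_kernel p z t)"
proof -
  define c where "c = 1 + cmod (of_real x - z)"
  have "c \<ge> 1" by (simp add: c_def)
  have bound: "cmod (of_real (trunc_powr p t x) * frac_kernel p z t) \<le> c powr p * (1 / (4 + (t - Re z)\<^sup>2))" for t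
  proof -
    let ?w = "cmod (of_real t - z)"
    have w: "2 \<le> ?w" by (rule two_le_cmod_denominator)
    have "\<bar>t - x\<bar> \<le> ?w + cmod (of_real x - z)"
      using norm_triangle_ineq4[of "of_real t - z" "of_real x - z"] by (simp flip: of_real_diff)
    also have "\<dots> \<le> c * ?w"
      unfolding c_def using mult_left_mono[of 1 ?w "cmod (of_real x - z)"] w
      by (simp add: algebra_simps)
    finally have "max (t - x) 0 \<le> c * ?w" 
      using \<open>c \<ge> 1\<close> by (auto simp: max_def)
    then have "trunc_powr p t x \<le> (c * ?w) powr p"
      unfolding trunc_powr_def using p by (intro powr_mono2) auto
    also have "\<dots> = c powr p * ?w powr p"
      using \<open>c \<ge> 1\<close> by (simp add: powr_mult)
    finally have "trunc_powr p t x * cmod (frac_kernel p z t) \<le> (c powr p * ?w powr p) * cmod (frac_kernel p z t)"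
      by (intro mult_right_mono) auto
    also have "\<dots> = c powr p * (1 / ?w\<^sup>2)"
      unfolding norm_frac_kernel using denominator_nonzero[of t] by (simp add: powr_minus field_simps)
    also have "\<dots> \<le> c powr p * (1 / (4 + (t - Re z)\<^sup>2))"
      using cauchy_bound by (intro mult_left_mono) auto
    finally show ?thesis
      by (simp add: norm_mult trunc_powr_def)
  qed
  have [measurable]: "(\<lambda>t. trunc_powr p t x) \<in> borel_measurable borel"
    unfolding trunc_powr_def by measurable
  have "integrable lborel (\<lambda>t. c powr p * (1 / (4 + (t - Re z)\<^sup>2)))"
    by (intro integrable_mult_right integrable_cauchy_density)
  then show ?thesis
    by (rule Bochner_Integration.integrable_bound)
       (use bound in \<open>auto simp: abs_of_pos\<close>)
qed

text \<open>
  The function \<open>G(t) = ((t - x) / (t - z))\<^sup>p\<^sup>+\<^sup>1\<close> vanishes at \<open>x\<close>, tends to \<open>1\<close> at infinity, and for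
  \<open>t > x\<close> its derivative is the integrand times \<open>(p + 1) (x - z)\<close>.
\<close>

lemma resolvent_eq_integral:
  "(\<integral>t. of_real (trunc_powr p t x) * frac_kernel p z t \<partial>lborel) = - 1 / (of_real (p + 1) * (z - of_real x))"
proof -
  define s where "s = - complex_of_real (p + 1)"
  define G where "G t = of_real ((t - x) powr (p + 1)) * (of_real t - z) powr s" for t
  define g where "g t = of_real (p + 1) * (of_real x - z) * (of_real ((t - x) powr p) * frac_kernel p z t)" for t
  have xz: "of_real x - z \<noteq> 0" by (rule denominator_nonzero)
  have trunc: "of_real (trunc_powr p t x) * frac_kernel p z t =
      indicator {x<..} t *\<^sub>R (of_real ((t - x) powr p) * frac_kernel p z t)" for t
    by (simp add: trunc_powr_def indicator_def max_def)
  have der: "(G has_vector_derivative g t) (at t)" if "x < t" for t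
  proof -
    let ?w = "complex_of_real t - z"
    have d1: "((\<lambda>t. complex_of_real ((t - x) powr (p + 1))) has_vector_derivative
                of_real ((p + 1) * (t - x) powr p)) (at t)"
      using that
      by (intro has_vector_derivative_of_real)
         (auto simp flip: has_real_derivative_iff_has_vector_derivative intro!: derivative_eq_intros)
    have d2: "((\<lambda>t. (complex_of_real t - z) powr s) has_vector_derivative s * ?w powr (s - 1)) (at t)"
      using denominator_not_nonpos[of t]
      by (intro has_vector_derivative_real_field) (auto intro!: derivative_eq_intros)
    have sk: "?w powr (s - 1) = frac_kernel p z t"
      by (simp add: s_def frac_kernel_def algebra_simps)
    then have sk': "?w powr s = ?w * frac_kernel p z t"
      using powr_add[of ?w "s - 1" 1] denominator_nonzero[of t] by simp
    have pt: "(t - x) powr (p + 1) = (t - x) * (t - x) powr p"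
      using that by (simp add: powr_add)
    have "of_real ((t - x) powr (p + 1)) * (s * ?w powr (s - 1)) + of_real ((p + 1) * (t - x) powr p) * ?w powr s = g t"
      unfolding sk sk' pt unfolding g_def s_def by (simp add: algebra_simps)
    then show ?thesis
      unfolding G_def using has_vector_derivative_mult[OF d1 d2] by simp
  qed
  have cont: "isCont g t" if "x < t" for t
    unfolding g_def frac_kernel_def using that denominator_not_nonpos[of t]
    by (intro continuous_intros) auto
  have int: "set_integrable lborel {x<..} (\<lambda>t. of_real ((t - x) powr p) * frac_kernel p z t)"
    using integrable_trunc_powr_kernel[of x] unfolding set_integrable_def trunc .
  have lim0: "(G \<longlongrightarrow> 0) (at_right x)"
  proof -
    have l1: "((\<lambda>t. complex_of_real ((t - x) powr (p + 1))) \<longlongrightarrow> of_real 0) (at_right x)"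
      using p by (intro tendsto_of_real) (auto intro!: tendsto_eq_intros simp: eventually_at_filter)
    have l2: "((\<lambda>t. (complex_of_real t - z) powr s) \<longlongrightarrow> (of_real x - z) powr s) (at_right x)"
      using denominator_not_nonpos[of x] by (intro tendsto_intros) auto
    show ?thesis
      using tendsto_mult[OF l1 l2] unfolding G_def by simp
  qed
  have lim1: "(G \<longlongrightarrow> 1) at_top"
  proof -
    have "((\<lambda>t. 1 + (of_real x - z) * of_real (1 / (t - x))) \<longlongrightarrow> 1 + (of_real x - z) * of_real 0) at_top"
      by (intro tendsto_intros) real_asymp
    then have "((\<lambda>t. (1 + (of_real x - z) * of_real (1 / (t - x))) powr s) \<longlongrightarrow> 1 powr s) at_top"
      by (intro tendsto_powr_complex) auto
    moreover have "\<forall>\<^sub>F t in at_top. (1 + (of_real x - z) * of_real (1 / (t - x))) powr s = G t"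
      using eventually_gt_at_top[of x]
    proof eventually_elim
      case (elim t)
      \<comment> \<open>powers are multiplicative here because one factor is a positive real\<close>
      let ?y = "1 + (of_real x - z) * complex_of_real (1 / (t - x))"
      have "of_real (t - x) * ?y = of_real t - z"
        using elim by (simp add: field_simps)
      then have "(of_real t - z) powr s = of_real (t - x) powr s * ?y powr s"
        using elim powr_times_real_left[of "of_real (t - x)" ?y s] by simp
      also have "complex_of_real (t - x) powr s = of_real ((t - x) powr (- (p + 1)))"
        using elim powr_of_real[of "t - x" "- (p + 1)"] by (simp add: s_def)
      finally have "(of_real t - z) powr s = of_real ((t - x) powr (- (p + 1))) * ?y powr s" .
      moreover have "complex_of_real ((t - x) powr (p + 1)) * of_real ((t - x) powr (- (p + 1))) = 1"
        using elim by (simp flip: of_real_mult powr_add)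
      ultimately show ?case
        unfolding G_def by (simp only: mult.assoc[symmetric] mult_1_left)
    qed
    ultimately show ?thesis
      by (auto intro: Lim_transform_eventually)
  qed
  have "(LBINT t=ereal x..\<infinity>. g t) = 1 - 0"
  proof (rule interval_integral_FTC_integrable)
    show "set_integrable lborel (einterval (ereal x) \<infinity>) g"
      using int unfolding g_def by (auto simp: einterval_eq)
  qed (use der cont lim0 lim1 in \<open>auto simp: ereal_tendsto_simps\<close>)
  then have prod: "of_real (p + 1) * (of_real x - z) *
      (\<integral>t. of_real (trunc_powr p t x) * frac_kernel p z t \<partial>lborel) = 1"
    unfolding interval_integral_to_infinity_eq g_def set_integral_mult_right
    by (simp add: set_lebesgue_integral_def trunc)
  have neg: "of_real (p + 1) * (z - of_real x) = - (of_real (p + 1) * (of_real x - z))"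
    by (simp add: algebra_simps)
  have "F * I = 1 \<Longrightarrow> I = - 1 / - F" for F I :: complex
    by (cases "F = 0") (auto simp: field_simps)
  then show ?thesis
    unfolding neg using prod .
qed

end

text \<open>
  The logarithm of the Gamma function is convex and vanishes at \<open>1\<close> and \<open>2\<close>: it is nonpositive
  between these points and nonnegative to the left of \<open>1\<close>.
\<close>

lemma Gamma_le_one:
  assumes "1 \<le> x" "x \<le> 2"
  shows "Gamma (x::real) \<le> 1"
proof -
  have "(ln \<circ> Gamma) ((1 - (x - 1)) *\<^sub>R 1 + (x - 1) *\<^sub>R 2) \<le>
        (1 - (x - 1)) * (ln \<circ> Gamma) 1 + (x - 1) * (ln \<circ> Gamma) (2 :: real)"
    using assms by (intro convex_onD[OF log_convex_Gamma_real]) auto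
  then have "ln (Gamma x) \<le> 0"
    by (simp add: Gamma_numeral)
  then show ?thesis
    using assms by simp
qed

lemma one_le_Gamma:
  assumes "0 < x" "x \<le> 1"
  shows "1 \<le> Gamma (x::real)"
proof -
  \<comment> \<open>the weight with which \<open>1\<close> lies between \<open>2\<close> and \<open>x\<close>\<close>
  define \<theta> where "\<theta> = 1 / (2 - x)"
  have \<theta>: "0 < \<theta>" "\<theta> \<le> 1" "\<theta> * (2 - x) = 1"
    using assms by (auto simp: \<theta>_def)
  have conv: "(ln \<circ> Gamma) ((1 - \<theta>) *\<^sub>R 2 + \<theta> *\<^sub>R x) \<le>
        (1 - \<theta>) * (ln \<circ> Gamma) (2 :: real) + \<theta> * (ln \<circ> Gamma) x"
    using assms \<theta> by (intro convex_onD[OF log_convex_Gamma_real]) auto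
  have eq: "(1 - \<theta>) *\<^sub>R 2 + \<theta> *\<^sub>R x = 1"
    using \<theta>(3) by (simp add: algebra_simps)
  with conv have "(ln \<circ> Gamma) 1 \<le> (1 - \<theta>) * (ln \<circ> Gamma) (2 :: real) + \<theta> * (ln \<circ> Gamma) x"
    by (simp only: eq)
  then have "0 \<le> \<theta> * ln (Gamma x)"
    by (simp add: Gamma_numeral)
  then have "0 \<le> ln (Gamma x)"
    using \<theta>(1) by (simp add: zero_le_mult_iff)
  then show ?thesis
    using assms by simp
qed

section \<open>Stieltjes transforms of spectral measures\<close>

lemma sum_eigval: "(\<Sum>i = 1..n. f (eigval A i)) = (\<Sum>i<n. f (eigvals A ! i))"
  by (rule sum.reindex_bij_witness[of _ Suc "\<lambda>i. i - 1"]) (auto simp: eigval_def)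

lemma stieltjes_spectral_measure:
  assumes "n \<ge> 1"
  shows "stieltjes (spectral_measure n A) z = (\<Sum>i<n. 1 / (z - of_real (eigvals A ! i))) / of_nat n"
proof -
  have meas: "eigval A \<in> uniform_count_measure {1..n} \<rightarrow>\<^sub>M borel"
    by (auto simp: measurable_def space_uniform_count_measure sets_uniform_count_measure)
  have "stieltjes (spectral_measure n A) z =
      (\<integral>i. 1 / (z - of_real (eigval A i)) \<partial>uniform_count_measure {1..n})"
    unfolding stieltjes_def spectral_measure_def by (rule integral_distr[OF meas]) measurable
  also have "\<dots> = (\<Sum>i = 1..n. 1 / (z - of_real (eigval A i))) / of_nat n"
    unfolding uniform_count_measure_def
    by (subst lebesgue_integral_point_measure_finite) (auto simp: sum_divide_distrib scaleR_conv_of_real mult.commute)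
  finally show ?thesis
    by (simp only: sum_eigval[of "\<lambda>x. 1 / (z - complex_of_real x)"])
qed

text \<open>
  The trace of the resolvent depends linearly on the function \<open>t \<mapsto> F\<^sub>t\<close>, through integration against
  \<open>frac_kernel\<close>, so a bound on the difference that is uniform in \<open>t\<close> costs only the \<open>L\<^sup>1\<close> norm of the
  kernel.
\<close>

lemma resolvent_trace_diff_le:
  assumes p: "0 < p" and z: "2 \<le> Im z"
    and M: "\<And>t. \<bar>trunc_trace p n t A - trunc_trace p n t B\<bar> \<le> M"
  shows "cmod ((\<Sum>i<n. 1 / (z - of_real (eigvals A ! i))) - (\<Sum>i<n. 1 / (z - of_real (eigvals B ! i))))
         \<le> (p + 1) * (pi / 2) * M"
proof -
  have "M \<ge> 0"
    using M[of 0] by linarith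
  have single: "1 / (z - of_real x) =
      - of_real (p + 1) * (\<integral>t. of_real (trunc_powr p t x) * frac_kernel p z t \<partial>lborel)" for x
  proof -
    have cancel: "1 / w = - c * (- 1 / (c * w))" if "c \<noteq> 0" for c w :: complex
      using that by simp
    have nz: "complex_of_real (p + 1) \<noteq> 0"
      unfolding of_real_eq_0_iff using p by linarith
    show ?thesis
      unfolding resolvent_eq_integral[OF p z] by (rule cancel[OF nz])
  qed
  have res: "(\<Sum>i<n. 1 / (z - of_real (eigvals C ! i))) =
      - of_real (p + 1) * (\<integral>t. of_real (trunc_trace p n t C) * frac_kernel p z t \<partial>lborel)" for C
    unfolding single trunc_trace_def of_real_sum sum_distrib_right sum_distrib_left[symmetric]
    by (subst Bochner_Integration.integral_sum) (auto intro: integrable_trunc_powr_kernel[OF p z])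
  have int: "integrable lborel (\<lambda>t. of_real (trunc_trace p n t C) * frac_kernel p z t)" for C
    unfolding trunc_trace_def of_real_sum sum_distrib_right
    by (intro Bochner_Integration.integrable_sum integrable_trunc_powr_kernel[OF p z])
  have "(\<Sum>i<n. 1 / (z - of_real (eigvals A ! i))) - (\<Sum>i<n. 1 / (z - of_real (eigvals B ! i))) =
      - of_real (p + 1) *
        (\<integral>t. of_real (trunc_trace p n t A - trunc_trace p n t B) * frac_kernel p z t \<partial>lborel)"
    unfolding res of_real_diff left_diff_distrib Bochner_Integration.integral_diff[OF int int]
    by (simp only: right_diff_distrib)
  also have "cmod \<dots> = (p + 1) *
      cmod (\<integral>t. of_real (trunc_trace p n t A - trunc_trace p n t B) * frac_kernel p z t \<partial>lborel)"
    unfolding norm_mult norm_minus_cancel norm_of_real using p by simp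
  also have "\<dots> \<le> (p + 1) * (\<integral>t. M * cmod (frac_kernel p z t) \<partial>lborel)"
  proof (intro mult_left_mono Bochner_Integration.integral_norm_bound_integral)
    show "integrable lborel (\<lambda>t. of_real (trunc_trace p n t A - trunc_trace p n t B) * frac_kernel p z t)"
      unfolding of_real_diff left_diff_distrib by (intro Bochner_Integration.integrable_diff int)
    show "integrable lborel (\<lambda>t. M * cmod (frac_kernel p z t))"
      by (intro integrable_mult_right integrable_frac_kernel[OF p z])
    show "cmod (of_real (trunc_trace p n t A - trunc_trace p n t B) * frac_kernel p z t)
        \<le> M * cmod (frac_kernel p z t)" for t
      unfolding norm_mult norm_of_real by (intro mult_right_mono M) auto
  qed (use p in auto)
  also have "\<dots> = (p + 1) * (M * (\<integral>t. cmod (frac_kernel p z t) \<partial>lborel))"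
    by simp
  also have "\<dots> \<le> (p + 1) * (M * (pi / 2))"
    using p \<open>M \<ge> 0\<close> integral_norm_frac_kernel_le[OF p z] by (intro mult_left_mono) auto
  finally show ?thesis by (simp add: mult_ac)
qed

text \<open>
  The left side bounds the \<open>L\<^sup>1\<close> norm of the kernel at height \<open>Im z \<ge> 2\<close>; the right side is that
  norm at height \<open>1\<close>, which is why a crude estimate is enough.
\<close>

lemma pi_half_le_Gamma_quotient:
  assumes "0 < p" "p < 1"
  shows "pi / 2 \<le> sqrt pi * (Gamma ((p + 1) / 2) / Gamma (1 + p / 2))"
proof -
  have "1 \<le> Gamma ((p + 1) / 2)" "Gamma (1 + p / 2) \<le> 1"
    using assms by (auto intro: one_le_Gamma Gamma_le_one)
  moreover have "Gamma (1 + p / 2) > 0"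
    using assms by (intro Gamma_real_pos) auto
  ultimately have "1 \<le> Gamma ((p + 1) / 2) / Gamma (1 + p / 2)"
    by (simp add: field_simps)
  then have "sqrt pi * 1 \<le> sqrt pi * (Gamma ((p + 1) / 2) / Gamma (1 + p / 2))"
    by (intro mult_left_mono) auto
  moreover have "sqrt pi \<le> 2"
    using pi_less_4 real_sqrt_le_mono[of pi 4] by simp
  then have "sqrt pi * sqrt pi \<le> 2 * sqrt pi"
    by (intro mult_right_mono) auto
  then have "pi / 2 \<le> sqrt pi"
    by simp
  ultimately show ?thesis by linarith
qed

theorem lemma2p21:
  fixes p :: real and K :: "complex set"
  assumes "0 < p" "p < 1" and "admissible_set K"
  shows "(\<forall>n \<ge> 1. \<forall>\<beta> \<in> {1, 2}. \<forall>A \<in> Herm \<beta> n. \<forall>B \<in> Herm \<beta> n. \<forall>t::real.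
            \<bar>(\<Sum>i = 1..n. (max (t - eigval A i) 0) powr p)
              - (\<Sum>i = 1..n. (max (t - eigval B i) 0) powr p)\<bar>
            \<le> (\<Sum>i = 1..n. \<bar>eigval (A - B) i\<bar> powr p))
       \<and> (\<exists>C > 0. C = sqrt pi * (p + 1) * (Gamma ((p + 1) / 2) / Gamma (1 + p / 2))
            \<and> (\<forall>n \<ge> 1. \<forall>\<beta> \<in> {1, 2}. \<forall>A \<in> Herm \<beta> n. \<forall>B \<in> Herm \<beta> n.
                 stieltjes_dist K (spectral_measure n A) (spectral_measure n B)
                   \<le> C / real n * lp_norm_powr p (A - B)))"
proof -
  note p = assms(1,2)
  define C where "C = sqrt pi * (p + 1) * (Gamma ((p + 1) / 2) / Gamma (1 + p / 2))"
  have "C > 0"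
    unfolding C_def using p by (intro mult_pos_pos divide_pos_pos Gamma_real_pos) auto
  have C: "(p + 1) * (pi / 2) \<le> C"
    using mult_left_mono[OF pi_half_le_Gamma_quotient[OF p], of "p + 1"] p
    by (simp add: C_def mult_ac)
  have K: "K \<noteq> {}" "\<And>z. z \<in> K \<Longrightarrow> 2 \<le> Im z"
    using assms(3) by (auto simp: admissible_set_def)
  have part1: "\<bar>(\<Sum>i = 1..n. (max (t - eigval A i) 0) powr p)
              - (\<Sum>i = 1..n. (max (t - eigval B i) 0) powr p)\<bar>
            \<le> (\<Sum>i = 1..n. \<bar>eigval (A - B) i\<bar> powr p)"
    if "A \<in> Herm \<beta> n" "B \<in> Herm \<beta> n" for n \<beta> A B t
    using trunc_trace_diff_le_eigvals[OF p, of A n B t] that Herm_subset_Herm_2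
    unfolding sum_eigval[of "\<lambda>x. \<bar>x\<bar> powr p"] sum_eigval[of "\<lambda>x. max (t - x) 0 powr p"]
    by (auto simp: trunc_trace_def trunc_powr_def)
  have part2: "stieltjes_dist K (spectral_measure n A) (spectral_measure n B)
                   \<le> C / real n * lp_norm_powr p (A - B)"
    if n: "n \<ge> 1" and AB: "A \<in> Herm \<beta> n" "B \<in> Herm \<beta> n" for n \<beta> A B
    unfolding stieltjes_dist_def
  proof (rule cSUP_least[OF K(1)])
    fix z assume "z \<in> K"
    define N where "N = lp_norm_powr p (A - B)"
    have "N \<ge> 0"
      by (auto simp: N_def lp_norm_powr_def intro!: sum_nonneg)
    have "\<bar>trunc_trace p n t A - trunc_trace p n t B\<bar> \<le> N" for t
      unfolding N_def using AB Herm_subset_Herm_2 by (intro trunc_trace_diff_le_entries p) auto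
    then have "cmod ((\<Sum>i<n. 1 / (z - of_real (eigvals A ! i))) -
        (\<Sum>i<n. 1 / (z - of_real (eigvals B ! i)))) \<le> (p + 1) * (pi / 2) * N"
      using K(2)[OF \<open>z \<in> K\<close>] p(1) by (intro resolvent_trace_diff_le)
    also have "\<dots> \<le> C * N"
      using C \<open>N \<ge> 0\<close> by (rule mult_right_mono)
    finally show "cmod (stieltjes (spectral_measure n A) z - stieltjes (spectral_measure n B) z) \<le> C / real n * N"
      unfolding stieltjes_spectral_measure[OF n] using n
      by (simp add: norm_divide divide_right_mono flip: diff_divide_distrib)
  qed
  show ?thesis
  proof (intro conjI exI[of _ C] allI impI ballI)
    show "C > 0" by fact
    show "C = sqrt pi * (p + 1) * (Gamma ((p + 1) / 2) / Gamma (1 + p / 2))"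
      by (rule C_def)
  qed ((rule part1 part2; assumption)+)
qed

end
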